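(* Suppose $\mathfrak{g}$ is a (non-zero, finite-dimensional, complex) semisimple Lie algebra, different from (not isomorphic to) $\mathfrak{sl}_2$. Then there is a connected, finite simple graph $\Gamma=(\mathsf{V},\mathsf{E})$ such that $\mathcal{F}(A^\bullet_\Gamma,\mathfrak{g})\ne\bigcup_{\mathsf{W}\subseteq\mathsf{V}}S_{\mathsf{W}}$.
   Context: Everything is over $\mathbb{C}$. For a finite simplicial graph $\Gamma=(\mathsf{V},\mathsf{E})$, $A^\bullet_\Gamma=H^\bullet(\pi_\Gamma,\mathbb{C})$ is the cohomology algebra of the right-angled Artin group $\pi_\Gamma$ (generators $v\in\mathsf{V}$, relations $vw=wv$ for $\{v,w\}\in\mathsf{E}$), endowed with zero differential. It is the quotient of the exterior algebra on degree $1$ generators $v^*$, $v\in\mathsf{V}$, by the ideal generated by the monomials $v^*w^*$ with $\{v,w\}\notin\mathsf{E}$; thus $A^1_\Gamma=\mathbb{C}^{\mathsf{V}}$. For a commutative differential graded algebra $A$, $A\otimes\mathfrak{g}$ has bracket $[\alpha\otimes x,\beta\otimes y]=\alpha\beta\otimes[x,y]$ and differential $\partial(\alpha\otimes x)=d\alpha\otimes x$; the set of flat connections is $\mathcal{F}(A,\mathfrak{g})=\{\omega\in A^1\otimes\mathfrak{g}\mid\partial\omega+\frac12[\omega,\omega]=0\}$. Elements $\omega\in\mathbb{C}^{\mathsf{V}}\otimes\mathfrak{g}$ are written as tuples $(\omega_v)_{v\in\mathsf{V}}$ with $\omega_v\in\mathfrak{g}$. For $\mathsf{W}\subseteq\mathsf{V}$,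 let $\Gamma_{\mathsf{W}}$ be the induced subgraph, let $\mathsf{W}_1,\dots,\mathsf{W}_c$ be the vertex sets of its connected components, let $\overline{\mathsf{W}}=\mathsf{V}\setminus\mathsf{W}$, and put $$S_{\mathsf{W}}=\{\omega\in\mathbb{C}^{\mathsf{V}}\otimes\mathfrak{g}\mid\omega_v=0\text{ for }v\in\overline{\mathsf{W}},\ \operatorname{rank}\{\omega_v\}_{v\in\mathsf{W}_i}\le1\text{ for }1\le i\le c\},$$ where $\operatorname{rank}$ denotes the dimension of the linear span. *)

theory Defs
  imports
    "HOL-Analysis.Determinants"
    "HOL-Algebra.QuotRing"
    "HOL-Algebra.Module"
    "HOL-Library.Poly_Mapping"
    "Graph_Theory.Graph_Theory"
begin

section \<open>Complex Lie algebras\<close>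

locale lie_algebra = vector_space smul
  for smul :: "complex \<Rightarrow> 'g::ab_group_add \<Rightarrow> 'g" +
  fixes bracket :: "'g \<Rightarrow> 'g \<Rightarrow> 'g"
  assumes bracket_add_left: "bracket (x + y) z = bracket x z + bracket y z"
    and bracket_add_right: "bracket x (y + z) = bracket x y + bracket x z"
    and bracket_scale_left: "bracket (smul c x) y = smul c (bracket x y)"
    and bracket_scale_right: "bracket x (smul c y) = smul c (bracket x y)"
    and bracket_self: "bracket x x = 0"
    and jacobi: "bracket x (bracket y z) + bracket y (bracket z x) + bracket z (bracket x y) = 0"
begin

definition finite_dimensional :: bool where
  "finite_dimensional \<longleftrightarrow> (\<exists>B. finite B \<and> span B = UNIV)"

definition lie_ideal :: "'g set \<Rightarrow> bool" where
  "lie_ideal I \<longleftrightarrow> subspace I \<and> (\<forall>x. \<forall>y\<in>I. bracket x y \<in> I)"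

definition derived :: "'g set \<Rightarrow> 'g set" where
  "derived L = span {bracket x y | x y. x \<in> L \<and> y \<in> L}"

definition solvable :: "'g set \<Rightarrow> bool" where
  "solvable L \<longleftrightarrow> (\<exists>n. (derived ^^ n) L = {0})"

text \<open>The radical vanishes. The zero Lie algebra is not excluded here.\<close>

definition semisimple :: bool where
  "semisimple \<longleftrightarrow> (\<forall>I. lie_ideal I \<and> solvable I \<longrightarrow> I = {0})"

definition isomorphic_sl2 :: bool where
  "isomorphic_sl2 \<longleftrightarrow>
    (\<exists>f :: 'g \<Rightarrow> complex^2^2.
      (\<forall>x y. f (x + y) = f x + f y) \<and>
      (\<forall>c x. f (smul c x) = (\<chi> i j. c * f x $ i $ j)) \<and>
      (\<forall>x y. f (bracket x y) = f x ** f y - f y ** f x) \<and>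
      bij_betw f UNIV {M. trace M = 0})"

end


section \<open>Differential graded algebras\<close>

text \<open>
  A (not necessarily commutative) differential graded algebra over the complex numbers: the
  library's module record already carries a multiplication, a unit and a scalar action.
\<close>

record 'a dga = "(complex, 'a) module" +
  homog :: "nat \<Rightarrow> 'a set"
  differential :: "'a \<Rightarrow> 'a"

text \<open>
  The library quotient ring, with the scalar action, grading and differential induced on cosets.
\<close>

definition dga_quotient :: "('a, 'm) dga_scheme \<Rightarrow> 'a set \<Rightarrow> 'a set dga" where
  "dga_quotient A I =
    \<lparr>carrier = carrier (A Quot I), mult = mult (A Quot I), one = one (A Quot I),
     zero = zero (A Quot I), add = add (A Quot I),
     smult = (\<lambda>c X. \<Union>x\<in>X. I +>\<^bsub>A\<^esub> (c \<odot>\<^bsub>A\<^esub> x)),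
     homog = (\<lambda>n. (\<lambda>x. I +>\<^bsub>A\<^esub> x) ` homog A n),
     differential = (\<lambda>X. \<Union>x\<in>X. I +>\<^bsub>A\<^esub> differential A x)\<rparr>"

text \<open>
  Formal linear combinations are finitely supported functions; \<open>linear_ext\<close> and
  \<open>bilinear_ext\<close> extend an operation on basis elements linearly and bilinearly.
\<close>

definition pm_scale :: "complex \<Rightarrow> ('b \<Rightarrow>\<^sub>0 complex) \<Rightarrow> ('b \<Rightarrow>\<^sub>0 complex)" where
  "pm_scale c p = Poly_Mapping.map ((*) c) p"

definition linear_ext :: "('b \<Rightarrow> 'c) \<Rightarrow> ('b \<Rightarrow>\<^sub>0 complex) \<Rightarrow> ('c \<Rightarrow>\<^sub>0 complex)" where
  "linear_ext h p = (\<Sum>s\<in>Poly_Mapping.keys p. Poly_Mapping.single (h s) (Poly_Mapping.lookup p s))"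

definition bilinear_ext ::
    "('b \<Rightarrow> 'c \<Rightarrow> 'd) \<Rightarrow> ('b \<Rightarrow>\<^sub>0 complex) \<Rightarrow> ('c \<Rightarrow>\<^sub>0 complex) \<Rightarrow> ('d \<Rightarrow>\<^sub>0 complex)" where
  "bilinear_ext h p q =
    (\<Sum>s\<in>Poly_Mapping.keys p. \<Sum>t\<in>Poly_Mapping.keys q. Poly_Mapping.single (h s t) (Poly_Mapping.lookup p s * Poly_Mapping.lookup q t))"


section \<open>The algebra of a right-angled Artin group\<close>

text \<open>
  The tensor algebra of the vector space with basis \<open>V\<close>: words over \<open>V\<close> form a basis, and basis
  elements are multiplied by concatenation.
\<close>

definition tensor_algebra :: "'v set \<Rightarrow> ('v list \<Rightarrow>\<^sub>0 complex) dga" where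
  "tensor_algebra V =
    \<lparr>carrier = {p. Poly_Mapping.keys p \<subseteq> lists V}, mult = bilinear_ext (@), one = Poly_Mapping.single [] 1,
     zero = 0, add = (+), smult = pm_scale,
     homog = (\<lambda>n. {p. Poly_Mapping.keys p \<subseteq> {u \<in> lists V. length u = n}}),
     differential = (\<lambda>_. 0)\<rparr>"

definition exterior_ideal :: "'v set \<Rightarrow> ('v list \<Rightarrow>\<^sub>0 complex) set" where
  "exterior_ideal V = Idl\<^bsub>tensor_algebra V\<^esub>
    {x \<otimes>\<^bsub>tensor_algebra V\<^esub> x | x. x \<in> homog (tensor_algebra V) 1}"

definition exterior_algebra :: "'v set \<Rightarrow> ('v list \<Rightarrow>\<^sub>0 complex) set dga" where
  "exterior_algebra V = dga_quotient (tensor_algebra V) (exterior_ideal V)"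

definition exterior_gen :: "'v set \<Rightarrow> 'v \<Rightarrow> ('v list \<Rightarrow>\<^sub>0 complex) set" where
  "exterior_gen V v = exterior_ideal V +>\<^bsub>tensor_algebra V\<^esub> Poly_Mapping.single [v] 1"

definition raag_ideal :: "'v pair_pre_digraph \<Rightarrow> ('v list \<Rightarrow>\<^sub>0 complex) set set" where
  "raag_ideal G = Idl\<^bsub>exterior_algebra (pverts G)\<^esub>
    {exterior_gen (pverts G) v \<otimes>\<^bsub>exterior_algebra (pverts G)\<^esub> exterior_gen (pverts G) w | v w.
      v \<in> pverts G \<and> w \<in> pverts G \<and> (v, w) \<notin> parcs G}"

text \<open>
  The cohomology algebra, with zero differential, of the right-angled Artin group of \<open>G\<close>,
  in its standard presentation as a quotient of the exterior algebra.
  An edge \<open>{v, w}\<close> of \<open>G\<close> is represented by the two pairs \<open>(v, w)\<close> and \<open>(w, v)\<close>.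
\<close>

definition raag_algebra :: "'v pair_pre_digraph \<Rightarrow> ('v list \<Rightarrow>\<^sub>0 complex) set set dga" where
  "raag_algebra G = dga_quotient (exterior_algebra (pverts G)) (raag_ideal G)"

definition raag_gen :: "'v pair_pre_digraph \<Rightarrow> 'v \<Rightarrow> ('v list \<Rightarrow>\<^sub>0 complex) set set" where
  "raag_gen G v = raag_ideal G +>\<^bsub>exterior_algebra (pverts G)\<^esub> exterior_gen (pverts G) v"


text \<open>
  All three algebras are rings, so the ideals generated above are ideals in the library's sense.
\<close>

lemma bilinear_ext_superset:
  assumes "finite S" "finite T" "Poly_Mapping.keys p \<subseteq> S" "Poly_Mapping.keys q \<subseteq> T"
  shows "bilinear_ext h p q = (\<Sum>s\<in>S. \<Sum>t\<in>T.
    Poly_Mapping.single (h s t) (Poly_Mapping.lookup p s * Poly_Mapping.lookup q t))"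
proof -
  have "bilinear_ext h p q = (\<Sum>s\<in>Poly_Mapping.keys p. \<Sum>t\<in>T.
    Poly_Mapping.single (h s t) (Poly_Mapping.lookup p s * Poly_Mapping.lookup q t))"
    unfolding bilinear_ext_def
    by (intro sum.cong refl sum.mono_neutral_left)
       (use assms in \<open>auto simp: in_keys_iff\<close>)
  also have "\<dots> = (\<Sum>s\<in>S. \<Sum>t\<in>T.
    Poly_Mapping.single (h s t) (Poly_Mapping.lookup p s * Poly_Mapping.lookup q t))"
    by (intro sum.mono_neutral_left)
       (use assms in \<open>auto simp: in_keys_iff\<close>)
  finally show ?thesis .
qed

lemma bilinear_ext_add_left:
  "bilinear_ext h (p + p') q = bilinear_ext h p q + bilinear_ext h p' q"
proof -
  let ?S = "Poly_Mapping.keys p \<union> Poly_Mapping.keys p'"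
  let ?T = "Poly_Mapping.keys q"
  have k: "Poly_Mapping.keys (p + p') \<subseteq> ?S" by (rule Poly_Mapping.keys_add)
  have "finite ?S" "finite ?T" by auto
  note b = bilinear_ext_superset[OF this]
  show ?thesis
    using k by (simp add: b lookup_add distrib_right single_add sum.distrib)
qed

lemma bilinear_ext_add_right:
  "bilinear_ext h q (p + p') = bilinear_ext h q p + bilinear_ext h q p'"
proof -
  let ?S = "Poly_Mapping.keys p \<union> Poly_Mapping.keys p'"
  let ?T = "Poly_Mapping.keys q"
  have k: "Poly_Mapping.keys (p + p') \<subseteq> ?S" by (rule Poly_Mapping.keys_add)
  have "finite ?T" "finite ?S" by auto
  note b = bilinear_ext_superset[OF this]
  show ?thesis
    using k by (simp add: b lookup_add distrib_left single_add sum.distrib)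
qed

lemma bilinear_ext_0 [simp]: "bilinear_ext h 0 q = 0" "bilinear_ext h p 0 = 0"
  by (simp_all add: bilinear_ext_def)

lemma bilinear_ext_single [simp]:
  "bilinear_ext h (Poly_Mapping.single s a) (Poly_Mapping.single t b)
     = Poly_Mapping.single (h s t) (a * b)"
  by (subst bilinear_ext_superset[of "{s}" "{t}"]) (auto split: if_splits)

lemma pm_induct [case_names zero single sum]:
  assumes "P 0" "\<And>s a. P (Poly_Mapping.single s a)" "\<And>p q. P p \<Longrightarrow> P q \<Longrightarrow> P (p + q)"
  shows "P (p :: 'b \<Rightarrow>\<^sub>0 complex)"
proof -
  have p: "p = (\<Sum>k\<in>Poly_Mapping.keys p. Poly_Mapping.single k (Poly_Mapping.lookup p k))"
    by (rule poly_mapping_eqI) (auto simp: lookup_sum lookup_single when_def in_keys_iff)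
  have "P (\<Sum>k\<in>S. Poly_Mapping.single k (Poly_Mapping.lookup p k))" if "finite S" for S
    using that by (induction S rule: finite_induct) (auto intro: assms)
  then show ?thesis by (subst p) simp
qed

lemma bilinear_ext_assoc:
  assumes "\<And>a b c. h (h a b) c = h a (h b c)"
  shows "bilinear_ext h (bilinear_ext h p q) r = bilinear_ext h p (bilinear_ext h q r)"
proof (induction p rule: pm_induct)
  case zero show ?case by simp
next
  case (sum p1 p2) then show ?case by (simp add: bilinear_ext_add_left)
next
  case p: (single s a)
  show ?case
  proof (induction q rule: pm_induct)
  case zero show ?case by simp
next
    case (sum p1 p2) then show ?case by (simp add: bilinear_ext_add_left bilinear_ext_add_right)
  next
    case q: (single t b)
    show ?case
    proof (induction r rule: pm_induct)
  case zero show ?case by simp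
next
      case (sum p1 p2) then show ?case by (simp add: bilinear_ext_add_right)
    next
      case (single u c)
      show ?case by (simp add: assms mult.assoc)
    qed
  qed
qed

lemma keys_bilinear_ext:
  "Poly_Mapping.keys (bilinear_ext h p q) \<subseteq> {h s t | s t. s \<in> Poly_Mapping.keys p \<and> t \<in> Poly_Mapping.keys q}"
  unfolding bilinear_ext_def
  by (rule order_trans[OF Poly_Mapping.keys_sum] UN_least)+ auto

lemma ring_tensor_algebra: "ring (tensor_algebra V)"
proof (rule ringI)
  show "abelian_group (tensor_algebra V)"
  proof (rule abelian_groupI)
    fix x assume x: "x \<in> carrier (tensor_algebra V)"
    show "\<exists>y\<in>carrier (tensor_algebra V). y \<oplus>\<^bsub>tensor_algebra V\<^esub> x = \<zero>\<^bsub>tensor_algebra V\<^esub>"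
      by (rule bexI[of _ "- x"]) (use x in \<open>auto simp: tensor_algebra_def\<close>)
  qed (use Poly_Mapping.keys_add in \<open>fastforce simp: tensor_algebra_def algebra_simps\<close>)+
  have one: "bilinear_ext (@) (Poly_Mapping.single [] 1) p = p"
            "bilinear_ext (@) p (Poly_Mapping.single [] 1) = p" for p :: "'a list \<Rightarrow>\<^sub>0 complex"
    by (induction p rule: pm_induct; simp add: bilinear_ext_add_left bilinear_ext_add_right)+
  show "Group.monoid (tensor_algebra V)"
  proof (rule monoidI)
    fix x y assume "x \<in> carrier (tensor_algebra V)" "y \<in> carrier (tensor_algebra V)"
    then show "x \<otimes>\<^bsub>tensor_algebra V\<^esub> y \<in> carrier (tensor_algebra V)"
      using keys_bilinear_ext[of "(@)" x y] by (fastforce simp: tensor_algebra_def)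
  qed (auto simp: tensor_algebra_def one bilinear_ext_assoc)
qed (auto simp: tensor_algebra_def bilinear_ext_add_left bilinear_ext_add_right)

lemma ring_dga_quotient:
  assumes "ideal I A"
  shows "ring (dga_quotient A I)"
proof -
  interpret ideal I A by fact
  have "ring (A Quot I)" by (rule quotient_is_ring)
  then interpret Q: ring "A Quot I" .
  show ?thesis
  proof (rule ringI)
    show "abelian_group (dga_quotient A I)"
    proof (rule abelian_groupI)
      fix x assume "x \<in> carrier (dga_quotient A I)"
      then show "\<exists>y\<in>carrier (dga_quotient A I). y \<oplus>\<^bsub>dga_quotient A I\<^esub> x = \<zero>\<^bsub>dga_quotient A I\<^esub>"
        using Q.l_neg by (auto simp: dga_quotient_def)
    qed (simp_all add: dga_quotient_def Q.a_assoc Q.a_comm Q.a_lcomm)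
    show "Group.monoid (dga_quotient A I)"
      by (rule monoidI) (auto simp: dga_quotient_def Q.m_assoc)
  qed (auto simp: dga_quotient_def Q.l_distr Q.r_distr)
qed

lemma ideal_exterior_ideal: "ideal (exterior_ideal V) (tensor_algebra V)"
proof -
  interpret ring "tensor_algebra V" by (rule ring_tensor_algebra)
  show ?thesis unfolding exterior_ideal_def
    by (rule genideal_ideal) (fastforce simp: tensor_algebra_def dest!: subsetD[OF keys_bilinear_ext])
qed

lemma ring_exterior_algebra: "ring (exterior_algebra V)"
  unfolding exterior_algebra_def by (intro ring_dga_quotient ideal_exterior_ideal)

lemma exterior_gen_carrier: "v \<in> V \<Longrightarrow> exterior_gen V v \<in> carrier (exterior_algebra V)"
proof -
  interpret ideal "exterior_ideal V" "tensor_algebra V" by (rule ideal_exterior_ideal)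
  assume "v \<in> V"
  then show ?thesis
    using a_rcosetsI[OF a_subset, of "Poly_Mapping.single [v] 1"]
    by (auto simp: exterior_gen_def exterior_algebra_def dga_quotient_def FactRing_def tensor_algebra_def)
qed

lemma ideal_raag_ideal: "ideal (raag_ideal G) (exterior_algebra (pverts G))"
proof -
  interpret ring "exterior_algebra (pverts G)" by (rule ring_exterior_algebra)
  show ?thesis unfolding raag_ideal_def
    by (rule genideal_ideal) (auto intro: exterior_gen_carrier)
qed

lemma ring_raag_algebra: "ring (raag_algebra G)"
  unfolding raag_algebra_def by (intro ring_dga_quotient ideal_raag_ideal)


section \<open>Flat connections\<close>

text \<open>
  The tensor product of \<open>A\<close> and \<open>\<gg>\<close> is the space of formal linear combinations of pairs modulo
  the bilinearity relations. Its elements are the classes \<open>tensor_class A smul t\<close>, where \<open>t\<close> is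
  supported on \<open>carrier A \<times> UNIV\<close>, and \<open>Poly_Mapping.single (a, x) 1\<close> represents the pure
  tensor of \<open>a\<close> and \<open>x\<close>.
\<close>

definition tensor_relations ::
    "('a, 'm) dga_scheme \<Rightarrow> (complex \<Rightarrow> 'g::ab_group_add \<Rightarrow> 'g) \<Rightarrow> ('a \<times> 'g \<Rightarrow>\<^sub>0 complex) set" where
  "tensor_relations A smul = module.span pm_scale
    ({Poly_Mapping.single (a \<oplus>\<^bsub>A\<^esub> b, x) 1 - Poly_Mapping.single (a, x) 1
        - Poly_Mapping.single (b, x) 1 | a b x. a \<in> carrier A \<and> b \<in> carrier A} \<union>
     {Poly_Mapping.single (a, x + y) 1 - Poly_Mapping.single (a, x) 1
        - Poly_Mapping.single (a, y) 1 | a x y. a \<in> carrier A} \<union>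
     {Poly_Mapping.single (c \<odot>\<^bsub>A\<^esub> a, x) 1 - Poly_Mapping.single (a, x) c | a c x. a \<in> carrier A} \<union>
     {Poly_Mapping.single (a, smul c x) 1 - Poly_Mapping.single (a, x) c | a c x. a \<in> carrier A})"

definition tensor_class ::
    "('a, 'm) dga_scheme \<Rightarrow> (complex \<Rightarrow> 'g::ab_group_add \<Rightarrow> 'g) \<Rightarrow> ('a \<times> 'g \<Rightarrow>\<^sub>0 complex)
      \<Rightarrow> ('a \<times> 'g \<Rightarrow>\<^sub>0 complex) set" where
  "tensor_class A smul t = {t + r | r. r \<in> tensor_relations A smul}"

definition tensor_bracket ::
    "('a, 'm) dga_scheme \<Rightarrow> ('g \<Rightarrow> 'g \<Rightarrow> 'g)
      \<Rightarrow> ('a \<times> 'g \<Rightarrow>\<^sub>0 complex) \<Rightarrow> ('a \<times> 'g \<Rightarrow>\<^sub>0 complex) \<Rightarrow> ('a \<times> 'g \<Rightarrow>\<^sub>0 complex)" where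
  "tensor_bracket A bracket = bilinear_ext (\<lambda>(a, x) (b, y). (a \<otimes>\<^bsub>A\<^esub> b, bracket x y))"

definition tensor_differential ::
    "('a, 'm) dga_scheme \<Rightarrow> ('a \<times> 'g \<Rightarrow>\<^sub>0 complex) \<Rightarrow> ('a \<times> 'g \<Rightarrow>\<^sub>0 complex)" where
  "tensor_differential A = linear_ext (\<lambda>(a, x). (differential A a, x))"

text \<open>
  The bracket and the differential respect the bilinearity relations, so the flatness equation
  does not depend on the representative \<open>t\<close>.
\<close>

definition flat_connections ::
    "('a, 'm) dga_scheme \<Rightarrow> (complex \<Rightarrow> 'g::ab_group_add \<Rightarrow> 'g) \<Rightarrow> ('g \<Rightarrow> 'g \<Rightarrow> 'g)
      \<Rightarrow> ('a \<times> 'g \<Rightarrow>\<^sub>0 complex) set set" where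
  "flat_connections A smul bracket =
    {tensor_class A smul t | t. Poly_Mapping.keys t \<subseteq> homog A 1 \<times> UNIV \<and>
      tensor_class A smul
        (tensor_differential A t + pm_scale (1/2) (tensor_bracket A bracket t t))
      = tensor_class A smul 0}"


section \<open>The sets indexed by vertex subsets\<close>

definition raag_tuple ::
    "'v pair_pre_digraph \<Rightarrow> (complex \<Rightarrow> 'g::ab_group_add \<Rightarrow> 'g) \<Rightarrow> ('v \<Rightarrow> 'g)
      \<Rightarrow> (('v list \<Rightarrow>\<^sub>0 complex) set set \<times> 'g \<Rightarrow>\<^sub>0 complex) set" where
  "raag_tuple G smul \<omega> =
    tensor_class (raag_algebra G) smul (\<Sum>v\<in>pverts G. Poly_Mapping.single (raag_gen G v, \<omega> v) 1)"

text \<open>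
  For a symmetric digraph, the strongly connected components are the connected components of the
  underlying graph; \<open>\<restriction>\<close> is the induced subgraph.
\<close>

definition S_set ::
    "'v pair_pre_digraph \<Rightarrow> (complex \<Rightarrow> 'g::ab_group_add \<Rightarrow> 'g) \<Rightarrow> 'v set
      \<Rightarrow> (('v list \<Rightarrow>\<^sub>0 complex) set set \<times> 'g \<Rightarrow>\<^sub>0 complex) set set" where
  "S_set G smul W =
    raag_tuple G smul `
      {\<omega>. (\<forall>v\<in>pverts G - W. \<omega> v = 0) \<and>
          (\<forall>C\<in>pre_digraph.sccs_verts (with_proj G \<restriction> W).
            vector_space.dim smul (module.span smul (\<omega> ` C)) \<le> 1)}"

end

theory Submission
  imports Defs "HOL-Computational_Algebra.Fundamental_Theorem_Algebra"
begin

text \<open>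
  A single edge already works as \<open>\<Gamma>\<close>. On an edge, every commuting pair \<open>(x, y)\<close> is a flat
  connection, whereas a tuple in some \<open>S\<^sub>W\<close> with both entries nonzero must have proportional
  entries, because \<open>W\<close> is then the whole (connected) edge. So it suffices to prove a statement
  about Lie algebras: a nonzero semisimple \<open>\<gg>\<close> in which the centralizer of every nonzero
  element is a line is isomorphic to \<open>\<ss>\<ll>\<^sub>2\<close> (\<open>sl2_if_centralizers_are_lines\<close>).

  The argument is elementary. Some nonzero \<open>e\<close> is ad-nilpotent: if \<open>ad x\<close> is not nilpotent, it
  has an eigenvector \<open>e\<close> with nonzero eigenvalue, and \<open>ad e\<close> is nilpotent because it shifts the
  finitely many eigenvalues of \<open>ad x\<close> by that amount. Since \<open>ker (ad e)\<close> is a line, \<open>ad e\<close> is a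
  single nilpotent Jordan block, and one climbs up its chain starting from \<open>e\<close>. The first step
  gives \<open>h\<close> with \<open>[h,e] = 2e\<close>; the second gives \<open>f\<close> with \<open>[e,f] = h\<close> and \<open>[h,f] = -2f\<close>. Both
  steps are possible, as otherwise \<open>\<gg>\<close> would be solvable. A third step would give a \<open>w\<close> of weight
  \<open>-4\<close>. Applying \<open>ad f\<close> to it repeatedly, one finds a last nonzero vector; it commutes with \<open>f\<close>
  and has weight at most \<open>-4\<close>, so it is not a multiple of \<open>f\<close>, contrary to the assumption on
  centralizers. Hence \<open>h, e, f\<close> span \<open>\<gg>\<close>.

  What remains is to see that the pair \<open>(x, y)\<close> can be recovered from its class in
  \<open>A\<^sup>1 \<otimes> \<gg>\<close>, that is, that the generators \<open>v\<^sup>*\<close> remain linearly independent in the iterated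
  quotient of the tensor algebra. For this, each coordinate function in degree one is made part of an
  algebra homomorphism \<open>\<epsilon> + \<delta>t\<close> to the dual numbers \<open>\<complex>[t]/(t\<^sup>2)\<close>. Such a homomorphism kills all products of
  two elements on which \<open>\<epsilon>\<close> vanishes, in particular the relations of both quotients, so
  it descends (\<open>raag_coordinate\<close>).
\<close>

section \<open>Eigenvectors of an operator on a complex vector space\<close>

lemma (in vector_space) span_pair: "x \<in> span {a, b} \<longleftrightarrow> (\<exists>c d. x = scale c a + scale d b)"
proof -
  have "x \<in> span {a, b} \<longleftrightarrow> (\<exists>c d. x = scale d b + scale c a)"
    by (simp add: span_breakdown_eq[of x a] span_singleton image_iff diff_eq_eq)
  then show ?thesis
    by (simp add: ac_simps)
qed

lemma (in vector_space) span_triple: "x \<in> span {a, b, c} \<longleftrightarrow> (\<exists>i j k. x = scale i a + scale j b + scale k c)"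
proof -
  have "x \<in> span {a, b, c} \<longleftrightarrow> (\<exists>i j k. x = scale j b + scale k c + scale i a)"
    by (simp add: span_breakdown_eq[of x a] span_pair diff_eq_eq)
  then show ?thesis
    by (simp add: ac_simps)
qed

locale finite_dimensional_operator = vector_space smul
  for smul :: "complex \<Rightarrow> 'g::ab_group_add \<Rightarrow> 'g" +
  fixes T :: "'g \<Rightarrow> 'g"
  assumes T_add: "T (x + y) = T x + T y"
    and T_scale: "T (smul c x) = smul c (T x)"
    and finite_spanning: "\<exists>B. finite B \<and> span B = UNIV"
begin

lemma T_zero [simp]: "T 0 = 0"
  using T_add[of 0 0] by simp

text \<open>
  Horner evaluation of the polynomial at the operator \<open>T\<close>, applied to \<open>z\<close>.
\<close>

definition act :: "complex poly \<Rightarrow> 'g \<Rightarrow> 'g" where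
  "act p z = fold_coeffs (\<lambda>a r. smul a z + T r) p 0"

lemma act_zero [simp]: "act 0 z = 0"
  by (simp add: act_def)

lemma act_pCons [simp]: "act (pCons a p) z = smul a z + T (act p z)"
  by (cases "a = 0 \<and> p = 0") (auto simp: act_def)

lemma act_add_left: "act (p + q) z = act p z + act q z"
  by (induction p q rule: poly_induct2) (simp_all add: T_add scale_left_distrib algebra_simps)

lemma act_smult: "act (Polynomial.smult c p) z = smul c (act p z)"
  by (induction p) (simp_all add: T_scale scale_right_distrib)

lemma act_mult: "act (p * q) z = act p (act q z)"
  by (induction p) (simp_all add: act_add_left act_smult)

lemma act_add_right: "act p (z + w) = act p z + act p w"
  by (induction p) (simp_all add: T_add scale_right_distrib algebra_simps)

lemma act_scale_right: "act p (smul c z) = smul c (act p z)"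
  by (induction p) (simp_all add: T_scale scale_right_distrib mult.commute)

lemma act_zero_right [simp]: "act p 0 = 0"
  by (induction p) simp_all

lemma act_monom: "act (monom a n) z = smul a ((T ^^ n) z)"
  by (induction n) (simp_all add: monom_0 monom_Suc T_scale)

lemma act_sum_left: "act (\<Sum>i\<in>I. p i) z = (\<Sum>i\<in>I. act (p i) z)"
  by (induction I rule: infinite_finite_induct) (simp_all add: act_add_left)

lemma act_eigenvector:
  assumes "T z = smul \<mu> z"
  shows "act p z = smul (poly p \<mu>) z"
  by (induction p) (simp_all add: assms T_scale scale_left_distrib mult.commute)

text \<open>
  One more iterate of \<open>z\<close> than the size of a spanning set must satisfy a linear relation, and a
  relation between the iterates is a polynomial in \<open>T\<close>.
\<close>

lemma annihilating_polynomial_of_vector: "\<exists>p. p \<noteq> 0 \<and> act p z = 0"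
proof -
  obtain B where B: "finite B" "span B = UNIV"
    using finite_spanning by blast
  define t where "t i = (T ^^ i) z" for i
  let ?I = "{..card B}"
  show ?thesis
  proof (cases "inj_on t ?I")
    case True
    then have "card (t ` ?I) = Suc (card B)"
      by (simp add: card_image)
    then have "dependent (t ` ?I)"
      using independent_span_bound[OF B(1), of "t ` ?I"] B(2) by auto
    then obtain u where u: "\<exists>v\<in>t ` ?I. u v \<noteq> 0" "(\<Sum>v\<in>t ` ?I. smul (u v) v) = 0"
      using dependent_finite[of "t ` ?I"] by auto
    define p where "p = (\<Sum>i\<in>?I. monom (u (t i)) i)"
    have "act p z = (\<Sum>i\<in>?I. smul (u (t i)) (t i))"
      by (simp add: p_def act_sum_left act_monom t_def)
    also have "\<dots> = 0"
      using u(2) by (simp add: sum.reindex[OF True])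
    finally have "act p z = 0" .
    moreover obtain j where j: "j \<in> ?I" "u (t j) \<noteq> 0"
      using u(1) by auto
    have "coeff p j = u (t j)"
      using j(1) by (simp add: p_def coeff_sum)
    ultimately show ?thesis
      using j(2) by (intro exI[of _ p]) auto
  next
    case False
    then obtain i j where ij: "i \<noteq> j" "t i = t j"
      by (auto simp: inj_on_def)
    define p where "p = monom 1 i + monom (-1 :: complex) j"
    have "coeff p i = 1"
      using ij(1) by (simp add: p_def)
    then have "p \<noteq> 0"
      by auto
    moreover have "act p z = 0"
      using ij(2) by (simp add: p_def act_add_left act_monom t_def)
    ultimately show ?thesis
      by blast
  qed
qed

lemma annihilating_polynomial: "\<exists>p. p \<noteq> 0 \<and> (\<forall>z. act p z = 0)"
proof -
  obtain B where B: "finite B" "span B = UNIV"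
    using finite_spanning by blast
  obtain q where q: "\<And>b. q b \<noteq> 0" "\<And>b. act (q b) b = 0"
    using annihilating_polynomial_of_vector by metis
  have "act (\<Prod>b\<in>B. q b) z = 0" if "z \<in> span B" for z
    using that
  proof (induction rule: span_induct_alt)
    case base show ?case by simp
  next
    case (step c b y)
    have "(\<Prod>b\<in>B. q b) = (\<Prod>b\<in>B - {b}. q b) * q b"
      using B(1) step(1) by (subst prod.remove[of B b]) (auto simp: mult.commute)
    then show ?case
      using step q(2) by (simp add: act_add_right act_scale_right act_mult)
  qed
  then show ?thesis
    using B q(1) by (intro exI[of _ "\<Prod>b\<in>B. q b"]) auto
qed

text \<open>
  Every eigenvalue is a root of an annihilating polynomial.
\<close>

lemma finite_eigenvalues: "finite {\<mu>. \<exists>z. z \<noteq> 0 \<and> T z = smul \<mu> z}"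
proof -
  obtain p where p: "p \<noteq> 0" "\<And>z. act p z = 0"
    using annihilating_polynomial by blast
  have "{\<mu>. \<exists>z. z \<noteq> 0 \<and> T z = smul \<mu> z} \<subseteq> {\<mu>. poly p \<mu> = 0}"
    using p(2) act_eigenvector[of _ _ p] by fastforce
  then show ?thesis
    using poly_roots_finite[OF p(1)] finite_subset by blast
qed

lemma eigenvectors_eventually_zero:
  assumes "\<And>k. T (u k) = smul (\<mu> k) (u k)" and "inj (\<mu> :: nat \<Rightarrow> complex)"
  shows "\<exists>k. u k = 0"
proof (rule ccontr)
  assume "\<not> (\<exists>k. u k = 0)"
  then have "range \<mu> \<subseteq> {\<mu>. \<exists>z. z \<noteq> 0 \<and> T z = smul \<mu> z}"
    using assms(1) by auto
  then have "finite (range \<mu>)"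
    using finite_eigenvalues finite_subset by blast
  then show False
    using assms(2) by (simp add: finite_image_iff)
qed

text \<open>
  Over the complex numbers an annihilating polynomial splits into linear factors. Applying
  them to a vector outside \<open>N\<close> one at a time, some factor carries the vector into \<open>N\<close> for the first
  time. It makes sense to ask for this modulo a subspace because \<open>N\<close> will be the generalized
  kernel of an operator, from which the error can be removed afterwards.
\<close>

lemma eigenvector_modulo_subspace:
  assumes N: "subspace N" and "N \<noteq> UNIV"
  shows "\<exists>y \<mu>. y \<notin> N \<and> T y - smul \<mu> y \<in> N"
proof -
  have *: "\<exists>y \<mu>. y \<notin> N \<and> T y - smul \<mu> y \<in> N" if "q \<noteq> 0" "act q z \<in> N" "z \<notin> N" for q z
    using that
  proof (induction "degree q" arbitrary: q)
    case 0
    then obtain c where c: "q = [:c:]" "c \<noteq> 0"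
      by (metis degree_eq_zeroE pCons_eq_0_iff)
    then show ?case
      using subspace_scale[OF N, of "smul c z" "inverse c"] 0 by simp
  next
    case (Suc n)
    then have "\<not> constant (poly q)"
      by (simp add: constant_degree)
    then obtain \<mu> where "poly q \<mu> = 0"
      using fundamental_theorem_of_algebra by blast
    then obtain r where r: "q = [:- \<mu>, 1:] * r"
      by (auto simp: poly_eq_0_iff_dvd)
    have "r \<noteq> 0"
      using Suc(3) r by auto
    moreover have "degree r = n"
      using Suc(2) \<open>r \<noteq> 0\<close> unfolding r by (subst (asm) degree_mult_eq) auto
    moreover have "act q z = T (act r z) - smul \<mu> (act r z)"
      unfolding r act_mult by (simp add: T_scale)
    ultimately show ?case
      using Suc by metis
  qed
  obtain z where "z \<notin> N"
    using assms(2) by blast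
  then show ?thesis
    using annihilating_polynomial * subspace_0[OF N] by metis
qed

lemma iterate_add: "(T ^^ k) (x + y) = (T ^^ k) x + (T ^^ k) y"
  by (induction k) (simp_all add: T_add)

lemma iterate_scale: "(T ^^ k) (smul c x) = smul c ((T ^^ k) x)"
  by (induction k) (simp_all add: T_scale)

lemma iterate_zero [simp]: "(T ^^ k) 0 = 0"
  by (induction k) simp_all

lemma iterate_diff: "(T ^^ k) (x - y) = (T ^^ k) x - (T ^^ k) y"
  using iterate_add[of k "x - y" y] by simp

lemma subspace_nilpotent_part: "subspace {z. \<exists>k. (T ^^ k) z = 0}"
proof (rule subspaceI)
  fix x y
  assume "x \<in> {z. \<exists>k. (T ^^ k) z = 0}" "y \<in> {z. \<exists>k. (T ^^ k) z = 0}"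
  then obtain i j where "(T ^^ i) x = 0" "(T ^^ j) y = 0"
    by blast
  then have "(T ^^ (j + i)) x = 0" "(T ^^ (i + j)) y = 0"
    by (simp_all only: funpow_add o_apply iterate_zero)
  then have "(T ^^ (i + j)) (x + y) = 0"
    by (simp add: iterate_add add.commute)
  then show "x + y \<in> {z. \<exists>k. (T ^^ k) z = 0}"
    by blast
qed (auto simp: iterate_scale)

end

section \<open>Lie algebras whose centralizers are lines\<close>

context lie_algebra
begin

definition ad_nilpotent :: "'g \<Rightarrow> bool" where
  "ad_nilpotent x \<longleftrightarrow> (\<forall>z. \<exists>k. (bracket x ^^ k) z = 0)"

definition centralizers_are_lines :: bool where
  "centralizers_are_lines \<longleftrightarrow> (\<forall>x y. x \<noteq> 0 \<longrightarrow> bracket x y = 0 \<longrightarrow> (\<exists>c. y = smul c x))"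

lemma bracket_zero_right [simp]: "bracket x 0 = 0"
  using bracket_add_right[of x 0 0] by simp

lemma bracket_zero_left [simp]: "bracket 0 x = 0"
  using bracket_add_left[of 0 0 x] by simp

lemma bracket_diff_right: "bracket x (y - z) = bracket x y - bracket x z"
  using bracket_add_right[of x "y - z" z] by simp

lemma bracket_minus_right: "bracket x (- y) = - bracket x y"
  using bracket_add_right[of x y "- y"] by (simp add: eq_neg_iff_add_eq_0 add.commute)

lemma bracket_anticommute: "bracket y x = - bracket x y"
proof -
  have "bracket (x + y) (x + y) = (bracket x x + bracket y x) + (bracket x y + bracket y y)"
    by (simp only: bracket_add_left bracket_add_right)
  then show ?thesis
    by (simp add: bracket_self eq_neg_iff_add_eq_0 add.commute)
qed

text \<open>
  The Jacobi identity says that \<open>ad x\<close> is a derivation.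
\<close>

lemma bracket_derivation:
  "bracket x (bracket y z) = bracket (bracket x y) z + bracket y (bracket x z)"
proof -
  have "bracket y (bracket z x) = - bracket y (bracket x z)"
    by (simp add: bracket_anticommute[of z x] bracket_minus_right)
  moreover have "bracket z (bracket x y) = - bracket (bracket x y) z"
    by (rule bracket_anticommute)
  ultimately show ?thesis
    using jacobi[of x y z] by (simp add: algebra_simps)
qed

lemma bracket_operator:
  assumes finite_dimensional
  shows "finite_dimensional_operator smul (bracket x)"
  using assms unfolding finite_dimensional_def
  by unfold_locales (simp_all add: bracket_add_right bracket_scale_right)

text \<open>
  The relation \<open>[ad h, (ad e)\<^sup>k] = k \<mu> (ad e)\<^sup>k\<close>: applying \<open>ad e\<close> raises weights by \<open>\<mu>\<close>.
\<close>

lemma bracket_iterate: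
  assumes "bracket h e = smul \<mu> e"
  shows "bracket h ((bracket e ^^ k) z)
    = (bracket e ^^ k) (bracket h z) + smul (of_nat k * \<mu>) ((bracket e ^^ k) z)"
proof (induction k)
  case 0 show ?case by simp
next
  case (Suc k)
  then show ?case
    by (simp add: bracket_derivation[of h e] assms bracket_scale_left bracket_add_right
        bracket_scale_right scale_left_distrib algebra_simps)
qed

text \<open>
  The vectors \<open>(ad e)\<^sup>k v\<close> have pairwise different weights, so they cannot all be nonzero.
\<close>

lemma raising_eventually_zero:
  assumes fin: finite_dimensional
    and e: "bracket h e = smul \<mu> e" "\<mu> \<noteq> 0"
    and v: "bracket h v = smul \<alpha> v"
  shows "\<exists>k. (bracket e ^^ k) v = 0"
proof -
  interpret H: finite_dimensional_operator smul "bracket h" by (rule bracket_operator[OF fin])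
  interpret E: finite_dimensional_operator smul "bracket e" by (rule bracket_operator[OF fin])
  have "bracket h ((bracket e ^^ k) v) = smul (\<alpha> + of_nat k * \<mu>) ((bracket e ^^ k) v)" for k
    by (simp add: bracket_iterate[OF e(1)] v E.iterate_scale scale_left_distrib)
  moreover have "inj (\<lambda>k. \<alpha> + of_nat k * \<mu>)"
    using e(2) by (auto intro!: injI)
  ultimately show ?thesis
    by (rule H.eigenvectors_eventually_zero)
qed

text \<open>
  The previous lemma makes \<open>ad e\<close> nilpotent on eigenvectors of \<open>ad h\<close>, but \<open>ad h\<close> need not be
  diagonalizable. Instead, an eigenvector modulo the generalized kernel of \<open>ad e\<close> turns into a true
  eigenvector after a power of \<open>ad e\<close> is applied, and hence lies in that generalized kernel itself.
\<close>

lemma ad_nilpotent_of_weight_vector: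
  assumes fin: finite_dimensional
    and e: "bracket h e = smul \<mu> e" "\<mu> \<noteq> 0"
  shows "ad_nilpotent e"
proof -
  interpret H: finite_dimensional_operator smul "bracket h" by (rule bracket_operator[OF fin])
  interpret E: finite_dimensional_operator smul "bracket e" by (rule bracket_operator[OF fin])
  define N where "N = {z. \<exists>k. (bracket e ^^ k) z = 0}"
  have "N = UNIV"
  proof (rule ccontr)
    assume "N \<noteq> UNIV"
    moreover have "subspace N"
      unfolding N_def by (rule E.subspace_nilpotent_part)
    ultimately obtain y \<alpha> where y: "y \<notin> N" "bracket h y - smul \<alpha> y \<in> N"
      using H.eigenvector_modulo_subspace by blast
    then obtain k where k: "(bracket e ^^ k) (bracket h y - smul \<alpha> y) = 0"
      unfolding N_def by blast
    then have "bracket h ((bracket e ^^ k) y) = smul (\<alpha> + of_nat k * \<mu>) ((bracket e ^^ k) y)"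
      by (simp add: bracket_iterate[OF e(1)] E.iterate_diff E.iterate_scale scale_left_distrib)
    then obtain j where "(bracket e ^^ j) ((bracket e ^^ k) y) = 0"
      using raising_eventually_zero[OF fin e] by blast
    then have "(bracket e ^^ (j + k)) y = 0"
      by (simp add: funpow_add)
    then show False
      using y(1) unfolding N_def by blast
  qed
  then show ?thesis
    unfolding ad_nilpotent_def N_def by blast
qed

text \<open>
  If \<open>ad x\<close> is not nilpotent, an eigenvector modulo its generalized kernel becomes, after a power
  of \<open>ad x\<close> is applied, a true eigenvector whose eigenvalue cannot be zero.
\<close>

lemma exists_ad_nilpotent:
  assumes fin: finite_dimensional and "(UNIV :: 'g set) \<noteq> {0}"
  shows "\<exists>e. e \<noteq> 0 \<and> ad_nilpotent e"
proof -
  obtain x :: 'g where "x \<noteq> 0"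
    using assms(2) by auto
  show ?thesis
  proof (cases "ad_nilpotent x")
    case True
    then show ?thesis
      using \<open>x \<noteq> 0\<close> by blast
  next
    case False
    interpret X: finite_dimensional_operator smul "bracket x" by (rule bracket_operator[OF fin])
    define N where "N = {z. \<exists>k. (bracket x ^^ k) z = 0}"
    have "N \<noteq> UNIV"
      using False unfolding N_def ad_nilpotent_def by blast
    moreover have "subspace N"
      unfolding N_def by (rule X.subspace_nilpotent_part)
    ultimately obtain y \<mu> where y: "y \<notin> N" "bracket x y - smul \<mu> y \<in> N"
      using X.eigenvector_modulo_subspace by blast
    then obtain k where "(bracket x ^^ k) (bracket x y - smul \<mu> y) = 0"
      unfolding N_def by blast
    moreover define e where "e = (bracket x ^^ k) y"
    ultimately have e: "bracket x e = smul \<mu> e"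
      by (simp add: X.iterate_diff X.iterate_scale funpow_swap1)
    have "e \<noteq> 0"
      using y(1) unfolding N_def e_def by blast
    moreover have "\<mu> \<noteq> 0"
    proof
      assume "\<mu> = 0"
      then have "(bracket x ^^ Suc k) y = 0"
        using e by (simp add: e_def)
      then show False
        using y(1) unfolding N_def by blast
    qed
    ultimately show ?thesis
      using ad_nilpotent_of_weight_vector[OF fin e] by blast
  qed
qed

text \<open>
  Under iteration of the nilpotent \<open>ad e\<close> every vector outside \<open>N\<close> finally enters \<open>N\<close>.
  This provides the next vector of the Jordan chain above \<open>N\<close>.
\<close>

lemma last_outside:
  assumes "ad_nilpotent e" and "0 \<in> N" and "N \<noteq> UNIV"
  shows "\<exists>x. x \<notin> N \<and> bracket e x \<in> N"
proof (rule ccontr)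
  assume *: "\<not> (\<exists>x. x \<notin> N \<and> bracket e x \<in> N)"
  obtain z where "z \<notin> N"
    using assms(3) by blast
  have "(bracket e ^^ k) z \<notin> N" for k
    using \<open>z \<notin> N\<close> * by (induction k) auto
  then show False
    using assms(1,2) unfolding ad_nilpotent_def by metis
qed

lemma centralizer_lineE:
  assumes "centralizers_are_lines" "x \<noteq> 0" "bracket x y = 0"
  obtains c where "y = smul c x"
  using assms unfolding centralizers_are_lines_def by blast

text \<open>
  Both \<open>[h, w]\<close> and \<open>(\<mu> - 2) w\<close> are mapped by \<open>ad e\<close> to the same vector, so they differ by a multiple
  of \<open>e\<close>. As \<open>e\<close> has weight \<open>2\<close>, this error can be absorbed by adding a multiple of \<open>e\<close>
  to \<open>w\<close>, unless the desired weight \<open>\<mu> - 2\<close> is itself \<open>2\<close>.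
\<close>

lemma weight_preimage:
  assumes lines: centralizers_are_lines
    and e: "e \<noteq> 0" "bracket h e = smul 2 e"
    and v: "bracket h v = smul \<mu> v" "\<mu> \<noteq> 4"
    and w: "bracket e w = v"
  shows "\<exists>w'. bracket h w' = smul (\<mu> - 2) w' \<and> bracket e w' = v"
proof -
  have "bracket e (bracket h w) = bracket h (bracket e w) - bracket (bracket h e) w"
    using bracket_derivation[of h e w] by simp
  also have "\<dots> = bracket e (smul (\<mu> - 2) w)"
    by (simp add: w v e bracket_scale_left bracket_scale_right bracket_diff_right scale_left_diff_distrib)
  finally have "bracket e (bracket h w - smul (\<mu> - 2) w) = 0"
    by (simp add: bracket_diff_right)
  then obtain c where "bracket h w - smul (\<mu> - 2) w = smul c e"
    using centralizer_lineE[OF lines e(1)] by blast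
  then have c: "bracket h w = smul (\<mu> - 2) w + smul c e"
    by (simp add: diff_eq_eq add.commute)
  \<comment> \<open>The solution of \<open>c + 2 d = (\<mu> - 2) d\<close>, which compares coefficients of \<open>e\<close>.\<close>
  define d where "d = c / (\<mu> - 4)"
  have "c + 2 * d = (\<mu> - 2) * d"
    using v(2) by (simp add: d_def field_simps)
  then have "smul c e + smul d (smul 2 e) = smul (\<mu> - 2) (smul d e)"
    by (simp add: mult.commute flip: scale_left_distrib)
  then have "bracket h (w + smul d e) = smul (\<mu> - 2) (w + smul d e)"
    by (simp add: bracket_add_right bracket_scale_right c e scale_right_distrib add.assoc)
  moreover have "bracket e (w + smul d e) = v"
    by (simp add: bracket_add_right bracket_scale_right bracket_self w)
  ultimately show ?thesis by blast
qed

lemma bracket_self_scale [simp]: "bracket (smul c x) (smul d x) = 0"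
  by (simp add: bracket_scale_left bracket_scale_right bracket_self)

lemma derived_line: "L \<subseteq> span {e} \<Longrightarrow> derived L \<subseteq> {0}"
  unfolding derived_def span_singleton
  by (rule span_minimal) (auto intro!: subspaceI, metis bracket_self_scale rangeE subsetD)

lemma solvable_if_derived_line:
  assumes "derived UNIV \<subseteq> span {e}"
  shows "solvable UNIV"
proof -
  have "derived (derived UNIV) \<subseteq> {0}"
    using assms by (rule derived_line)
  moreover have "0 \<in> derived (derived UNIV)"
    unfolding derived_def by (rule span_zero)
  ultimately have "(derived ^^ 2) UNIV = {0}"
    by (auto simp: numeral_2_eq_2)
  then show ?thesis
    unfolding solvable_def by blast
qed

lemma semisimple_not_solvable:
  assumes semisimple "(UNIV :: 'g set) \<noteq> {0}"
  shows "\<not> solvable UNIV"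
proof -
  have "lie_ideal UNIV"
    unfolding lie_ideal_def by simp
  then show ?thesis
    using assms unfolding semisimple_def by blast
qed

text \<open>
  The line \<open>\<complex>e\<close>, the plane spanned by \<open>e\<close> and \<open>h\<close>, and the span of \<open>h, e, f\<close> are the first steps
  of the kernel filtration of \<open>ad e\<close>. Each step produces the next vector unless it is everything.
  The first two are not, since \<open>\<gg>\<close> is not solvable; the third must be, since a further
  vector would lead to one that commutes with \<open>f\<close> without being a multiple of it.
\<close>

lemma exists_sl2_triple:
  assumes fin: finite_dimensional and nz: "(UNIV :: 'g set) \<noteq> {0}" and semisimple
    and lines: centralizers_are_lines
  obtains e h f where "e \<noteq> 0" "bracket h e = smul 2 e" "bracket h f = smul (-2) f" "bracket e f = h"
    "span {h, e, f} = UNIV"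
proof -
  have nsolv: "\<not> derived UNIV \<subseteq> span {e}" for e
    using semisimple_not_solvable solvable_if_derived_line assms by blast
  obtain e where e: "e \<noteq> 0" "ad_nilpotent e"
    using exists_ad_nilpotent[OF fin nz] by blast
  note central = centralizer_lineE[OF lines e(1)]
  have "span {e} \<noteq> UNIV"
    using nsolv[of e] by blast
  then obtain x where x: "x \<notin> span {e}" "bracket e x \<in> span {e}"
    using last_outside[OF e(2) span_zero] by blast
  then obtain c where c: "bracket e x = smul c e"
    by (auto simp: span_singleton)
  have "c \<noteq> 0"
    using x(1) c central[of x] by (auto simp: span_singleton)
  \<comment> \<open>The factor normalizes the weight of \<open>e\<close> to \<open>2\<close>.\<close>
  define h where "h = smul (- (2 / c)) x"
  have "bracket e h = smul (-2) e"
    using \<open>c \<noteq> 0\<close> by (simp add: h_def bracket_scale_right bracket_minus_right c)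
  then have eh: "bracket e h = - smul 2 e" by simp
  then have he: "bracket h e = smul 2 e"
    by (simp add: bracket_anticommute[of h e])

  have "derived UNIV \<subseteq> span {e}" if "span {e, h} = UNIV"
    unfolding derived_def
  proof (rule span_minimal[OF _ subspace_span], clarify)
    fix y z :: 'g
    have "y \<in> span {e, h}" "z \<in> span {e, h}"
      by (simp_all add: that)
    then obtain a b a' b' where "y = smul a e + smul b h" "z = smul a' e + smul b' h"
      unfolding span_pair by blast
    then have "bracket y z = smul (2 * (b * a' - a * b')) e"
      by (simp add: bracket_add_left bracket_add_right bracket_scale_left bracket_scale_right
          bracket_self eh he algebra_simps scale_left_diff_distrib scale_left_distrib)
    then show "bracket y z \<in> span {e}"
      by (auto simp: span_singleton)
  qed
  then have "span {e, h} \<noteq> UNIV"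
    using nsolv by blast
  then obtain x where x: "x \<notin> span {e, h}" "bracket e x \<in> span {e, h}"
    using last_outside[OF e(2) span_zero] by blast
  then obtain a b where ab: "bracket e x = smul a e + smul b h"
    by (auto simp: span_pair)
  \<comment> \<open>As \<open>[e, h] = -2e\<close>, this removes the component along \<open>e\<close>.\<close>
  define y where "y = x + smul (a / 2) h"
  have y: "bracket e y = smul b h"
    by (simp add: y_def bracket_add_right bracket_scale_right ab eh)
  have "b \<noteq> 0"
  proof
    assume "b = 0"
    then obtain c where "y = smul c e"
      using y central by auto
    then have "x = smul c e + smul (- (a / 2)) h"
      by (simp add: y_def algebra_simps)
    then show False
      using x(1) span_pair by blast
  qed
  have "bracket e (smul (inverse b) y) = h"
    using \<open>b \<noteq> 0\<close> by (simp add: bracket_scale_right y)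
  then obtain f where hf: "bracket h f = smul (-2) f" and ef: "bracket e f = h"
    using weight_preimage[OF lines e(1) he, of h 0] by (auto simp: bracket_self)
  have "h \<noteq> 0" "f \<noteq> 0"
    using he ef e(1) by auto

  have "span {h, e, f} = UNIV"
  proof (rule ccontr)
    assume "span {h, e, f} \<noteq> UNIV"
    then obtain x where x: "x \<notin> span {h, e, f}" "bracket e x \<in> span {h, e, f}"
      using last_outside[OF e(2) span_zero] by blast
    then obtain a b c where abc: "bracket e x = smul a h + smul b e + smul c f"
      by (auto simp: span_triple)
    \<comment> \<open>As \<open>[e, h] = -2e\<close> and \<open>[e, f] = h\<close>, this leaves only the component along \<open>f\<close>.\<close>
    define y where "y = x + smul (b / 2) h + smul (- a) f"
    have y: "bracket e y = smul c f"
      by (simp add: y_def bracket_add_right bracket_diff_right bracket_scale_right abc eh ef)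
    have "c \<noteq> 0"
    proof
      assume "c = 0"
      then obtain d where "y = smul d e"
        using y central by auto
      then have "x = smul (- (b / 2)) h + smul d e + smul a f"
        by (simp add: y_def algebra_simps)
      then show False
        using x(1) span_triple by blast
    qed
    have "bracket e (smul (inverse c) y) = f"
      using \<open>c \<noteq> 0\<close> by (simp add: bracket_scale_right y)
    then obtain w where hw: "bracket h w = smul (-4) w" and ew: "bracket e w = f"
      using weight_preimage[OF lines e(1) he hf] by auto
    have "w \<noteq> 0"
      using ew \<open>f \<noteq> 0\<close> by auto
    have iter: "bracket h ((bracket f ^^ k) w) = smul (-4 - 2 * of_nat k) ((bracket f ^^ k) w)" for k
    proof -
      interpret F: finite_dimensional_operator smul "bracket f" by (rule bracket_operator[OF fin])
      show ?thesis
        by (simp only: bracket_iterate[OF hf] hw F.iterate_scale flip: scale_left_distrib)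
          (simp add: mult.commute)
    qed
    have "\<exists>k. (bracket f ^^ k) w = 0"
      using raising_eventually_zero[OF fin hf _ hw] by simp
    moreover have "\<not> (bracket f ^^ 0) w = 0"
      using \<open>w \<noteq> 0\<close> by simp
    ultimately obtain k where k: "(bracket f ^^ k) w \<noteq> 0" "(bracket f ^^ Suc k) w = 0"
      using exists_least_lemma[of "\<lambda>k. (bracket f ^^ k) w = 0"] by blast
    then obtain d where d: "(bracket f ^^ k) w = smul d f"
      using centralizer_lineE[OF lines \<open>f \<noteq> 0\<close>] by auto
    then have "smul (-4 - 2 * of_nat k) (smul d f) = smul (-2) (smul d f)"
      using iter[of k] hf by (simp add: bracket_scale_right mult.commute)
    then have "(-4 - 2 * of_nat k :: complex) = -2"
      using k(1) d by (metis scale_right_imp_eq)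
    then have "of_nat (k + 1) = (0 :: complex)"
      by (simp add: algebra_simps)
    then show False
      by (metis add_is_0 of_nat_eq_0_iff one_neq_zero)
  qed
  then show thesis
    using that e(1) he hf ef by blast
qed

text \<open>
  The coordinates of an element with respect to \<open>h, e, f\<close> are the entries of the corresponding
  matrix; they are well defined because \<open>ad e\<close> detects linear relations between \<open>h, e, f\<close>.
\<close>

lemma isomorphic_sl2_of_triple:
  assumes e: "e \<noteq> 0" and he: "bracket h e = smul 2 e" and hf: "bracket h f = smul (-2) f"
    and ef: "bracket e f = h" and span: "span {h, e, f} = UNIV"
  shows isomorphic_sl2
proof -
  have eh: "bracket e h = smul (-2) e" and fh: "bracket f h = smul 2 f" and fe: "bracket f e = - h"
    using bracket_anticommute[of e h] bracket_anticommute[of f h] bracket_anticommute[of f e]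
    by (simp_all add: he hf ef)
  define \<phi> :: "complex \<Rightarrow> complex \<Rightarrow> complex \<Rightarrow> 'g" where
    "\<phi> a b c = smul a h + smul b e + smul c f" for a b c
  have zero: "a = 0 \<and> b = 0 \<and> c = 0" if "\<phi> a b c = 0" for a b c
  proof -
    have "h \<noteq> 0"
      using he e by auto
    \<comment> \<open>Two applications of \<open>ad e\<close> isolate the coefficient of \<open>f\<close>.\<close>
    have ad: "smul c h - smul (2 * a) e = 0"
      using arg_cong[OF that, of "bracket e"]
      by (simp add: \<phi>_def bracket_add_right bracket_scale_right bracket_minus_right bracket_self
          eh ef algebra_simps)
    have "smul (-2 * c) e = 0"
      using arg_cong[OF ad, of "bracket e"]
      by (simp add: bracket_diff_right bracket_scale_right bracket_minus_right bracket_self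
          eh algebra_simps)
    then have "c = 0"
      using e by simp
    then show ?thesis
      using ad that e by (simp add: \<phi>_def)
  qed
  have \<phi>_add: "\<phi> (a + a') (b + b') (c + c') = \<phi> a b c + \<phi> a' b' c'" for a b c a' b' c'
    by (simp add: \<phi>_def scale_left_distrib)
  have \<phi>_scale: "\<phi> (k * a) (k * b) (k * c) = smul k (\<phi> a b c)" for a b c k
    by (simp add: \<phi>_def scale_right_distrib)
  have \<phi>_bracket: "bracket (\<phi> a b c) (\<phi> a' b' c')
    = \<phi> (b * c' - c * b') (2 * (a * b' - b * a')) (2 * (c * a' - a * c'))" for a b c a' b' c'
    by (simp add: \<phi>_def bracket_add_left bracket_add_right bracket_scale_left bracket_scale_right
        bracket_minus_right bracket_self he hf ef eh fh fe algebra_simps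
        scale_left_diff_distrib scale_left_distrib)
  have inj: "a = a' \<and> b = b' \<and> c = c'" if "\<phi> a b c = \<phi> a' b' c'" for a b c a' b' c'
    using zero[of "a - a'" "b - b'" "c - c'"] that \<phi>_add[of "a - a'" a' "b - b'" b' "c - c'" c']
    by simp
  have "\<exists>a b c. x = \<phi> a b c" for x
    using span span_triple[of x h e f] by (simp add: \<phi>_def)
  then obtain \<alpha> \<beta> \<gamma> where coords: "\<And>x. x = \<phi> (\<alpha> x) (\<beta> x) (\<gamma> x)"
    by metis
  have coords_\<phi>: "\<alpha> (\<phi> a b c) = a" "\<beta> (\<phi> a b c) = b" "\<gamma> (\<phi> a b c) = c" for a b c
    using inj coords by metis+
  define M :: "complex \<Rightarrow> complex \<Rightarrow> complex \<Rightarrow> complex^2^2" where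
    "M a b c = vector [vector [a, b], vector [c, - a]]" for a b c
  define F where "F x = M (\<alpha> x) (\<beta> x) (\<gamma> x)" for x
  have F_\<phi>: "F (\<phi> a b c) = M a b c" for a b c
    by (simp add: F_def coords_\<phi>)
  have "F (x + y) = F x + F y" for x y
  proof -
    have "F (x + y) = F (\<phi> (\<alpha> x + \<alpha> y) (\<beta> x + \<beta> y) (\<gamma> x + \<gamma> y))"
      using coords by (metis \<phi>_add)
    also have "\<dots> = F x + F y"
      by (simp only: F_\<phi>) (simp add: F_def M_def vec_eq_iff forall_2)
    finally show ?thesis .
  qed
  moreover have "F (smul c x) = (\<chi> i j. c * F x $ i $ j)" for c x
  proof -
    have "F (smul c x) = F (\<phi> (c * \<alpha> x) (c * \<beta> x) (c * \<gamma> x))"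
      using coords by (metis \<phi>_scale)
    also have "\<dots> = (\<chi> i j. c * F x $ i $ j)"
      by (simp only: F_\<phi>) (simp add: F_def M_def vec_eq_iff forall_2)
    finally show ?thesis .
  qed
  moreover have "F (bracket x y) = F x ** F y - F y ** F x" for x y
  proof -
    have "F (bracket x y) = F (bracket (\<phi> (\<alpha> x) (\<beta> x) (\<gamma> x)) (\<phi> (\<alpha> y) (\<beta> y) (\<gamma> y)))"
      using coords by metis
    also have "\<dots> = F x ** F y - F y ** F x"
      by (simp only: \<phi>_bracket F_\<phi>)
        (simp add: F_def M_def vec_eq_iff forall_2 matrix_matrix_mult_def sum_2 algebra_simps)
    finally show ?thesis .
  qed
  moreover have "bij_betw F UNIV {M. trace M = 0}"
  proof (rule bij_betwI[where g = "\<lambda>m. \<phi> (m $ 1 $ 1) (m $ 1 $ 2) (m $ 2 $ 1)"])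
    show "F \<in> UNIV \<rightarrow> {M. trace M = 0}"
      by (simp add: F_def M_def trace_def sum_2)
    show "\<phi> (F x $ 1 $ 1) (F x $ 1 $ 2) (F x $ 2 $ 1) = x" for x
      using coords[of x] by (simp add: F_def M_def)
    show "F (\<phi> (m $ 1 $ 1) (m $ 1 $ 2) (m $ 2 $ 1)) = m" if "m \<in> {M. trace M = 0}" for m
      using that by (simp add: F_\<phi> M_def vec_eq_iff forall_2 trace_def sum_2 add_eq_0_iff)
  qed simp
  ultimately show ?thesis
    unfolding isomorphic_sl2_def by blast
qed

lemma sl2_if_centralizers_are_lines:
  assumes finite_dimensional "(UNIV :: 'g set) \<noteq> {0}" semisimple centralizers_are_lines
  shows isomorphic_sl2
  using exists_sl2_triple[OF assms] isomorphic_sl2_of_triple by metis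

end

section \<open>Coordinates on the cohomology algebra\<close>

text \<open>
  A homomorphism \<open>x \<mapsto> \<epsilon> x + \<delta> x t\<close> to the dual numbers \<open>\<complex>[t]/(t\<^sup>2)\<close>, or geometrically
  the point \<open>\<epsilon>\<close> with the tangent vector \<open>\<delta>\<close>. The axiom \<open>scalar\<close> expresses scalar
  multiplication through an element \<open>s\<close> that plays the part of \<open>c \<cdot> 1\<close>. In this form it passes to
  the quotient by a ring ideal, where the coset of \<open>s\<close> plays the same part.
\<close>

locale tangent_vector = ring A for A :: "('a, 'm) dga_scheme" (structure) +
  fixes \<epsilon> \<delta> :: "'a \<Rightarrow> complex"
  assumes eps_add: "\<lbrakk>x \<in> carrier A; y \<in> carrier A\<rbrakk> \<Longrightarrow> \<epsilon> (x \<oplus> y) = \<epsilon> x + \<epsilon> y"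
    and eps_mult: "\<lbrakk>x \<in> carrier A; y \<in> carrier A\<rbrakk> \<Longrightarrow> \<epsilon> (x \<otimes> y) = \<epsilon> x * \<epsilon> y"
    and delta_add: "\<lbrakk>x \<in> carrier A; y \<in> carrier A\<rbrakk> \<Longrightarrow> \<delta> (x \<oplus> y) = \<delta> x + \<delta> y"
    and delta_mult: "\<lbrakk>x \<in> carrier A; y \<in> carrier A\<rbrakk> \<Longrightarrow> \<delta> (x \<otimes> y) = \<epsilon> x * \<delta> y + \<delta> x * \<epsilon> y"
    and scalar: "\<exists>s\<in>carrier A. \<epsilon> s = c \<and> \<delta> s = 0 \<and> (\<forall>x\<in>carrier A. c \<odot> x = s \<otimes> x)"
begin

definition kernel :: "'a set" where
  "kernel = {x \<in> carrier A. \<epsilon> x = 0 \<and> \<delta> x = 0}"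

lemma delta_smult: "x \<in> carrier A \<Longrightarrow> \<delta> (c \<odot> x) = c * \<delta> x"
  using scalar[of c] delta_mult by fastforce

lemma eps_zero [simp]: "\<epsilon> \<zero> = 0"
  using eps_add[of \<zero> \<zero>] by simp

lemma delta_zero [simp]: "\<delta> \<zero> = 0"
  using delta_add[of \<zero> \<zero>] by simp

lemma eps_minus: "x \<in> carrier A \<Longrightarrow> \<epsilon> (\<ominus> x) = - \<epsilon> x"
  using eps_add[of x "\<ominus> x"] by (simp add: r_neg eq_neg_iff_add_eq_0 add.commute)

lemma delta_minus: "x \<in> carrier A \<Longrightarrow> \<delta> (\<ominus> x) = - \<delta> x"
  using delta_add[of x "\<ominus> x"] by (simp add: r_neg eq_neg_iff_add_eq_0 add.commute)

lemma ideal_kernel: "ideal kernel A"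
proof (rule idealI)
  show "ring A" by (rule ring_axioms)
  show "subgroup kernel (add_monoid A)"
    by (rule group.subgroupI[OF a_group])
      (auto simp: kernel_def eps_add delta_add eps_minus delta_minus simp flip: a_inv_def
        intro: exI[of _ \<zero>])
qed (auto simp: kernel_def eps_mult delta_mult)

lemma mult_in_kernel:
  "\<lbrakk>x \<in> carrier A; y \<in> carrier A; \<epsilon> x = 0; \<epsilon> y = 0\<rbrakk> \<Longrightarrow> x \<otimes> y \<in> kernel"
  by (simp add: kernel_def eps_mult delta_mult)

end

text \<open>
  The value of \<open>\<phi>\<close> at an arbitrary representative; of use when \<open>\<phi>\<close> is constant on the coset.
\<close>

definition on_cosets :: "('a \<Rightarrow> complex) \<Rightarrow> 'a set \<Rightarrow> complex" where
  "on_cosets \<phi> X = \<phi> (SOME x. x \<in> X)"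

lemma carrier_dga_quotient: "carrier (dga_quotient A I) = a_rcosets\<^bsub>A\<^esub> I"
  by (simp add: dga_quotient_def FactRing_def)

lemma carrier_dga_quotientE:
  assumes "X \<in> carrier (dga_quotient A I)"
  obtains x where "x \<in> carrier A" "X = I +>\<^bsub>A\<^esub> x"
  using assms by (auto simp: carrier_dga_quotient A_RCOSETS_def' )


lemma (in tangent_vector) on_cosets_eq:
  assumes "ideal I A" "I \<subseteq> kernel" "x \<in> carrier A"
  shows "on_cosets \<epsilon> (I +> x) = \<epsilon> x" "on_cosets \<delta> (I +> x) = \<delta> x"
proof -
  interpret I: ideal I A by fact
  have "(SOME y. y \<in> I +> x) \<in> I +> x"
    using I.a_rcos_self[OF assms(3)] by (rule someI)
  then obtain i where i: "i \<in> I" "(SOME y. y \<in> I +> x) = i \<oplus> x"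
    by (auto simp: a_r_coset_def' )
  then have "i \<in> carrier A" "\<epsilon> i = 0" "\<delta> i = 0"
    using assms(2) by (auto simp: kernel_def)
  then show "on_cosets \<epsilon> (I +> x) = \<epsilon> x" "on_cosets \<delta> (I +> x) = \<delta> x"
    by (simp_all add: on_cosets_def i(2) eps_add delta_add assms(3))
qed

text \<open>
  The ring operations on cosets are computed on representatives. The scalar action of the quotient
  is defined as a union over representatives, which collapses to a single coset because it
  is multiplication by \<open>s\<close>.
\<close>

lemma (in tangent_vector) tangent_vector_dga_quotient:
  assumes I: "ideal I A" "I \<subseteq> kernel"
  shows "tangent_vector (dga_quotient A I) (on_cosets \<epsilon>) (on_cosets \<delta>)"
proof -
  interpret I: ideal I A by fact
  let ?Q = "dga_quotient A I"
  interpret Q: ring ?Q by (rule ring_dga_quotient[OF I(1)])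
  note val = on_cosets_eq[OF I]
  have add: "(I +> x) \<oplus>\<^bsub>?Q\<^esub> (I +> y) = I +> (x \<oplus> y)" if "x \<in> carrier A" "y \<in> carrier A" for x y
    using I.a_rcos_sum[OF that] by (simp add: dga_quotient_def FactRing_def)
  have mult: "(I +> x) \<otimes>\<^bsub>?Q\<^esub> (I +> y) = I +> (x \<otimes> y)" if "x \<in> carrier A" "y \<in> carrier A" for x y
    using I.rcoset_mult_add[OF that] by (simp add: dga_quotient_def FactRing_def)
  show ?thesis
  proof
    fix X Y
    assume "X \<in> carrier ?Q" "Y \<in> carrier ?Q"
    then obtain x y where "x \<in> carrier A" "X = I +> x" "y \<in> carrier A" "Y = I +> y"
      by (elim carrier_dga_quotientE)
    then show "on_cosets \<epsilon> (X \<oplus>\<^bsub>?Q\<^esub> Y) = on_cosets \<epsilon> X + on_cosets \<epsilon> Y"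
      and "on_cosets \<epsilon> (X \<otimes>\<^bsub>?Q\<^esub> Y) = on_cosets \<epsilon> X * on_cosets \<epsilon> Y"
      and "on_cosets \<delta> (X \<oplus>\<^bsub>?Q\<^esub> Y) = on_cosets \<delta> X + on_cosets \<delta> Y"
      and "on_cosets \<delta> (X \<otimes>\<^bsub>?Q\<^esub> Y)
        = on_cosets \<epsilon> X * on_cosets \<delta> Y + on_cosets \<delta> X * on_cosets \<epsilon> Y"
      by (simp_all add: add mult val eps_add eps_mult delta_add delta_mult)
  next
    fix c
    obtain s where s: "s \<in> carrier A" "\<epsilon> s = c" "\<delta> s = 0" "\<And>x. x \<in> carrier A \<Longrightarrow> c \<odot> x = s \<otimes> x"
      using scalar by blast
    have "c \<odot>\<^bsub>?Q\<^esub> (I +> x) = (I +> s) \<otimes>\<^bsub>?Q\<^esub> (I +> x)" if x: "x \<in> carrier A" for x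
    proof -
      \<comment> \<open>All representatives contribute the same coset to the union defining \<open>\<odot>\<close>.\<close>
      have "I +> (c \<odot> y) = (I +> s) \<otimes>\<^bsub>?Q\<^esub> (I +> x)" if "y \<in> I +> x" for y
      proof -
        have "y \<in> carrier A"
          using a_r_coset_subset_G[OF I.a_subset x] that by blast
        moreover have "I +> y = I +> x"
          using a_repr_independence[OF that x I.a_subgroup] by simp
        ultimately show ?thesis
          using s by (metis mult)
      qed
      then have "(\<Union>y\<in>I +> x. I +> (c \<odot> y)) = (I +> s) \<otimes>\<^bsub>?Q\<^esub> (I +> x)"
        using I.a_rcos_self[OF x] by auto
      then show ?thesis
        by (simp add: dga_quotient_def)
    qed
    moreover have "I +> s \<in> carrier ?Q"
      using a_rcosetsI[OF I.a_subset s(1)] by (simp add: carrier_dga_quotient)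
    ultimately show "\<exists>S\<in>carrier ?Q. on_cosets \<epsilon> S = c \<and> on_cosets \<delta> S = 0
        \<and> (\<forall>X\<in>carrier ?Q. c \<odot>\<^bsub>?Q\<^esub> X = S \<otimes>\<^bsub>?Q\<^esub> X)"
      using s val by (intro bexI[of _ "I +> s"]) (auto elim!: carrier_dga_quotientE)
  qed
qed

lemma lookup_pm_scale [simp]: "Poly_Mapping.lookup (pm_scale c p) k = c * Poly_Mapping.lookup p k"
  by (simp add: pm_scale_def Poly_Mapping.map.rep_eq when_def)

lemma pm_scale_zero [simp]: "pm_scale c 0 = 0"
  by (rule poly_mapping_eqI) simp

lemma pm_scale_single [simp]: "pm_scale c (Poly_Mapping.single k a) = Poly_Mapping.single k (c * a)"
  by (rule poly_mapping_eqI) (simp add: lookup_single when_def)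

lemma pm_scale_add: "pm_scale c (p + q) = pm_scale c p + pm_scale c q"
  by (rule poly_mapping_eqI) (simp add: lookup_add distrib_left)

lemma vector_space_pm_scale: "vector_space pm_scale"
  by unfold_locales (auto intro!: poly_mapping_eqI simp: lookup_add algebra_simps)

lemma pm_scale_eq_mult: "pm_scale c p = bilinear_ext (@) (Poly_Mapping.single [] c) p"
proof (induction p rule: pm_induct)
  case zero show ?case by simp
qed (simp_all add: pm_scale_add bilinear_ext_add_right)

lemma lookup_mult_empty:
  "Poly_Mapping.lookup (bilinear_ext (@) p q) [] = Poly_Mapping.lookup p [] * Poly_Mapping.lookup q []"
proof (induction p rule: pm_induct)
  case (single s a)
  show ?case
    by (induction q rule: pm_induct)
      (auto simp: bilinear_ext_add_right lookup_add lookup_single when_def distrib_left)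
qed (simp_all add: bilinear_ext_add_left lookup_add distrib_right)

lemma lookup_mult_singleton:
  "Poly_Mapping.lookup (bilinear_ext (@) p q) [v] =
    Poly_Mapping.lookup p [] * Poly_Mapping.lookup q [v] + Poly_Mapping.lookup p [v] * Poly_Mapping.lookup q []"
proof (induction p rule: pm_induct)
  case (single s a)
  show ?case
    by (induction q rule: pm_induct)
      (auto simp: bilinear_ext_add_right lookup_add lookup_single when_def algebra_simps append_eq_Cons_conv)
qed (simp_all add: bilinear_ext_add_left lookup_add algebra_simps)

lemma tangent_vector_tensor_algebra:
  "tangent_vector (tensor_algebra V) (\<lambda>p. Poly_Mapping.lookup p []) (\<lambda>p. Poly_Mapping.lookup p [v])"
proof -
  interpret ring "tensor_algebra V" by (rule ring_tensor_algebra)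
  show ?thesis
  proof
    fix c
    show "\<exists>s\<in>carrier (tensor_algebra V). Poly_Mapping.lookup s [] = c \<and> Poly_Mapping.lookup s [v] = 0 \<and>
      (\<forall>x\<in>carrier (tensor_algebra V). c \<odot>\<^bsub>tensor_algebra V\<^esub> x = s \<otimes>\<^bsub>tensor_algebra V\<^esub> x)"
      by (rule bexI[of _ "Poly_Mapping.single [] c"])
        (auto simp: tensor_algebra_def pm_scale_eq_mult lookup_single)
  qed (simp_all add: tensor_algebra_def lookup_add lookup_mult_empty lookup_mult_singleton)
qed

lemma exterior_ideal_subset_kernel:
  "exterior_ideal V \<subseteq> tangent_vector.kernel (tensor_algebra V)
    (\<lambda>p. Poly_Mapping.lookup p []) (\<lambda>p. Poly_Mapping.lookup p [v])"
proof -
  interpret T: tangent_vector "tensor_algebra V" "\<lambda>p. Poly_Mapping.lookup p []" "\<lambda>p. Poly_Mapping.lookup p [v]"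
    by (rule tangent_vector_tensor_algebra)
  show ?thesis
    unfolding exterior_ideal_def
  proof (rule T.genideal_minimal[OF T.ideal_kernel], clarify)
    fix x assume x: "x \<in> homog (tensor_algebra V) 1"
    then have "x \<in> carrier (tensor_algebra V)" "Poly_Mapping.lookup x [] = 0"
      by (auto simp: tensor_algebra_def in_keys_iff)
    then show "x \<otimes>\<^bsub>tensor_algebra V\<^esub> x \<in> T.kernel"
      by (intro T.mult_in_kernel)
  qed
qed

text \<open>
  The constant term and the coefficient of the word \<open>[v]\<close> form a tangent vector of the tensor
  algebra. The relations of the two quotients are products of two elements without constant term,
  so this tangent vector descends twice.
\<close>

lemma raag_coordinate:
  fixes G :: "'v pair_pre_digraph"
  shows "\<exists>\<epsilon> \<delta>. tangent_vector (raag_algebra G) \<epsilon> \<delta> \<and>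
    (\<forall>w\<in>pverts G. \<delta> (raag_gen G w) = (if w = v then 1 else 0))"
proof -
  let ?V = "pverts G"
  let ?\<epsilon> = "\<lambda>p. Poly_Mapping.lookup p ([] :: 'v list) :: complex"
  let ?\<delta> = "\<lambda>p. Poly_Mapping.lookup p [v] :: complex"
  interpret T: tangent_vector "tensor_algebra ?V" ?\<epsilon> ?\<delta>
    by (rule tangent_vector_tensor_algebra)
  note I = ideal_exterior_ideal[of ?V] exterior_ideal_subset_kernel[of ?V v]
  interpret E: tangent_vector "exterior_algebra ?V" "on_cosets ?\<epsilon>" "on_cosets ?\<delta>"
    unfolding exterior_algebra_def by (rule T.tangent_vector_dga_quotient[OF I])
  have single: "Poly_Mapping.single [w] 1 \<in> carrier (tensor_algebra ?V)" if "w \<in> ?V" for w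
    using that by (simp add: tensor_algebra_def)
  have gen: "on_cosets ?\<epsilon> (exterior_gen ?V w) = 0"
    "on_cosets ?\<delta> (exterior_gen ?V w) = (if w = v then 1 else 0)" if "w \<in> ?V" for w
    unfolding exterior_gen_def
    by (simp_all add: T.on_cosets_eq[OF I single[OF that]] lookup_single)
  have J: "raag_ideal G \<subseteq> E.kernel"
    unfolding raag_ideal_def
    by (rule E.genideal_minimal[OF E.ideal_kernel])
      (auto intro!: E.mult_in_kernel exterior_gen_carrier simp: gen)
  have "tangent_vector (raag_algebra G) (on_cosets (on_cosets ?\<epsilon>)) (on_cosets (on_cosets ?\<delta>))"
    unfolding raag_algebra_def by (rule E.tangent_vector_dga_quotient[OF ideal_raag_ideal J])
  moreover have "on_cosets (on_cosets ?\<delta>) (raag_gen G w) = (if w = v then 1 else 0)" if "w \<in> ?V" for w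
    unfolding raag_gen_def
    using E.on_cosets_eq(2)[OF ideal_raag_ideal J exterior_gen_carrier[OF that]] gen(2)[OF that] by simp
  ultimately show ?thesis
    by blast
qed

section \<open>Recovering a tuple from its tensor class\<close>

text \<open>
  The map \<open>\<delta> \<otimes> id : A \<otimes> \<gg> \<rightarrow> \<gg>\<close>, on formal linear combinations of pairs.
\<close>

definition contract ::
    "(complex \<Rightarrow> 'g::ab_group_add \<Rightarrow> 'g) \<Rightarrow> ('a \<Rightarrow> complex) \<Rightarrow> ('a \<times> 'g \<Rightarrow>\<^sub>0 complex) \<Rightarrow> 'g" where
  "contract smul \<delta> t = (\<Sum>k\<in>Poly_Mapping.keys t. smul (Poly_Mapping.lookup t k * \<delta> (fst k)) (snd k))"


locale complex_vector_space = vector_space smul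
  for smul :: "complex \<Rightarrow> 'g::ab_group_add \<Rightarrow> 'g"
begin

lemma contract_superset:
  assumes "finite S" "Poly_Mapping.keys t \<subseteq> S"
  shows "contract smul \<delta> t = (\<Sum>k\<in>S. smul (Poly_Mapping.lookup t k * \<delta> (fst k)) (snd k))"
  unfolding contract_def
  by (intro sum.mono_neutral_left) (use assms in \<open>auto simp: in_keys_iff\<close>)

lemma contract_single [simp]: "contract smul \<delta> (Poly_Mapping.single (a, x) c) = smul (c * \<delta> a) x"
  by (subst contract_superset[of "{(a, x)}"]) auto

lemma contract_zero [simp]: "contract smul \<delta> 0 = 0"
  by (simp add: contract_def)

lemma contract_add: "contract smul \<delta> (s + t) = contract smul \<delta> s + contract smul \<delta> t"
proof -
  let ?S = "Poly_Mapping.keys s \<union> Poly_Mapping.keys t"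
  have "contract smul \<delta> p = (\<Sum>k\<in>?S. smul (Poly_Mapping.lookup p k * \<delta> (fst k)) (snd k))"
    if "Poly_Mapping.keys p \<subseteq> ?S" for p
    using that by (intro contract_superset) simp_all
  then show ?thesis
    using Poly_Mapping.keys_add[of s t]
    by (simp add: lookup_add distrib_right scale_left_distrib sum.distrib)
qed

lemma contract_scale: "contract smul \<delta> (pm_scale c t) = smul c (contract smul \<delta> t)"
proof (induction t rule: pm_induct)
  case zero show ?case by simp
next
  case (single k a) then show ?case by (cases k) (simp add: mult.assoc)
qed (simp_all add: pm_scale_add contract_add scale_right_distrib)

lemma contract_sum: "contract smul \<delta> (\<Sum>i\<in>I. t i) = (\<Sum>i\<in>I. contract smul \<delta> (t i))"
  by (induction I rule: infinite_finite_induct) (simp_all add: contract_add)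

lemma contract_diff: "contract smul \<delta> (s - t) = contract smul \<delta> s - contract smul \<delta> t"
  using contract_add[of \<delta> "s - t" t] by (simp add: eq_diff_eq)

lemma contract_tensor_relations:
  assumes "tangent_vector A \<epsilon> \<delta>" "r \<in> tensor_relations A smul"
  shows "contract smul \<delta> r = 0"
proof -
  interpret A: tangent_vector A \<epsilon> \<delta> by fact
  interpret pm: vector_space pm_scale by (rule vector_space_pm_scale)
  show ?thesis
    using assms(2) unfolding tensor_relations_def
  proof (induction rule: pm.span_induct_alt)
    case base show ?case by simp
  next
    case (step c r s)
    have "contract smul \<delta> r = 0"
      using step(1)
      by (auto simp: contract_diff A.delta_add A.delta_smult scale_left_distrib scale_right_distrib mult.commute)
    then show ?case
      using step(2) by (simp add: contract_add contract_scale)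
  qed
qed

lemma contract_tensor_class_eq:
  assumes "tangent_vector A \<epsilon> \<delta>" "tensor_class A smul s = tensor_class A smul t"
  shows "contract smul \<delta> s = contract smul \<delta> t"
proof -
  interpret pm: vector_space pm_scale by (rule vector_space_pm_scale)
  have "0 \<in> tensor_relations A smul"
    unfolding tensor_relations_def by (rule pm.span_zero)
  then have "s \<in> tensor_class A smul s"
    by (force simp: tensor_class_def)
  then have "s \<in> tensor_class A smul t"
    by (simp only: assms(2))
  then obtain r where "s = t + r" "r \<in> tensor_relations A smul"
    unfolding tensor_class_def by blast
  then show ?thesis
    by (simp add: contract_add contract_tensor_relations[OF assms(1)])
qed

text \<open>
  Contraction with the \<open>v\<close>-th coordinate of the cohomology algebra extracts the \<open>v\<close>-th entry.
\<close>

lemma raag_tuple_eqD: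
  assumes "finite (pverts G)" "v \<in> pverts G" "raag_tuple G smul \<omega> = raag_tuple G smul \<omega>'"
  shows "\<omega> v = \<omega>' v"
proof -
  obtain \<epsilon> \<delta> where t: "tangent_vector (raag_algebra G) \<epsilon> \<delta>"
    and \<delta>: "\<And>w. w \<in> pverts G \<Longrightarrow> \<delta> (raag_gen G w) = (if w = v then 1 else 0)"
    using raag_coordinate[of G v] by blast
  have "contract smul \<delta> (\<Sum>w\<in>pverts G. Poly_Mapping.single (raag_gen G w, \<eta> w) 1) = \<eta> v" for \<eta>
  proof -
    have "contract smul \<delta> (\<Sum>w\<in>pverts G. Poly_Mapping.single (raag_gen G w, \<eta> w) 1)
      = (\<Sum>w\<in>pverts G. if w = v then \<eta> w else 0)"
      unfolding contract_sum by (intro sum.cong) (simp_all add: \<delta>)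
    then show ?thesis
      using assms(1,2) by (simp add: sum.delta)
  qed
  then show ?thesis
    using contract_tensor_class_eq[OF t assms(3)[unfolded raag_tuple_def]] by simp
qed

text \<open>
  Additivity gives \<open>0 \<otimes> x = 0 \<otimes> x + 0 \<otimes> x\<close>.
\<close>

lemma single_zero_left_relation:
  assumes "ring A"
  shows "Poly_Mapping.single (\<zero>\<^bsub>A\<^esub>, x) c \<in> tensor_relations A smul"
proof -
  interpret A: ring A by fact
  interpret pm: vector_space pm_scale by (rule vector_space_pm_scale)
  let ?s = "Poly_Mapping.single (\<zero>\<^bsub>A\<^esub>, x) (1 :: complex)"
  have "?s - ?s - ?s = Poly_Mapping.single (\<zero>\<^bsub>A\<^esub> \<oplus>\<^bsub>A\<^esub> \<zero>\<^bsub>A\<^esub>, x) 1 - ?s - ?s"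
    by simp
  then have "?s - ?s - ?s \<in> tensor_relations A smul"
    unfolding tensor_relations_def by (intro pm.span_base UnI1) blast
  then have "pm_scale (- c) (?s - ?s - ?s) \<in> tensor_relations A smul"
    unfolding tensor_relations_def by (rule pm.span_scale)
  moreover have "pm_scale (- c) (?s - ?s - ?s) = Poly_Mapping.single (\<zero>\<^bsub>A\<^esub>, x) c"
    by (rule poly_mapping_eqI) (simp add: lookup_single when_def lookup_minus)
  ultimately show ?thesis
    by simp
qed

lemma single_zero_right_relation:
  assumes "a \<in> carrier A"
  shows "Poly_Mapping.single (a, 0) c \<in> tensor_relations A smul"
proof -
  interpret pm: vector_space pm_scale by (rule vector_space_pm_scale)
  \<comment> \<open>The scaling relation for \<open>(1 - c) \<cdot> 0 = 0\<close>, whose two terms differ by the coefficient \<open>c\<close>.\<close>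
  have "Poly_Mapping.single (a, smul (1 - c) 0) 1 - Poly_Mapping.single (a, 0) (1 - c)
    \<in> tensor_relations A smul"
    unfolding tensor_relations_def using assms
    by (intro pm.span_base UnI2) blast
  then show ?thesis
    by (simp flip: single_diff)
qed

end


section \<open>Commuting tuples are flat\<close>

lemma differential_dga_quotient_zero:
  assumes "ideal I A" "\<And>x. x \<in> carrier A \<Longrightarrow> differential A x = \<zero>\<^bsub>A\<^esub>"
    and X: "X \<in> carrier (dga_quotient A I)"
  shows "differential (dga_quotient A I) X = \<zero>\<^bsub>dga_quotient A I\<^esub>"
proof -
  interpret ideal I A by fact
  obtain x where x: "x \<in> carrier A" "X = I +>\<^bsub>A\<^esub> x"
    using X by (rule carrier_dga_quotientE)
  have "X \<subseteq> carrier A" "x \<in> X"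
    using a_r_coset_subset_G[OF a_subset x(1)] a_rcos_self[OF x(1)] x(2) by auto
  moreover have "I +>\<^bsub>A\<^esub> \<zero>\<^bsub>A\<^esub> = I"
    using a_subset by (rule a_coset_add_zero)
  ultimately have "I +>\<^bsub>A\<^esub> differential A y = I" if "y \<in> X" for y
    using assms(2)[of y] that by auto
  then have "(\<Union>y\<in>X. I +>\<^bsub>A\<^esub> differential A y) = I"
    using \<open>x \<in> X\<close> by auto
  then show ?thesis
    by (simp add: dga_quotient_def FactRing_def)
qed

lemma differential_raag_algebra:
  assumes "X \<in> carrier (raag_algebra G)"
  shows "differential (raag_algebra G) X = \<zero>\<^bsub>raag_algebra G\<^esub>"
proof -
  have "differential (exterior_algebra (pverts G)) Y = \<zero>\<^bsub>exterior_algebra (pverts G)\<^esub>"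
    if "Y \<in> carrier (exterior_algebra (pverts G))" for Y
    using that unfolding exterior_algebra_def
    by (intro differential_dga_quotient_zero[OF ideal_exterior_ideal]) (simp_all add: tensor_algebra_def)
  then show ?thesis
    using assms unfolding raag_algebra_def
    by (intro differential_dga_quotient_zero[OF ideal_raag_ideal])
qed

lemma raag_gen_carrier: "v \<in> pverts G \<Longrightarrow> raag_gen G v \<in> carrier (raag_algebra G)"
proof -
  interpret ideal "raag_ideal G" "exterior_algebra (pverts G)" by (rule ideal_raag_ideal)
  assume "v \<in> pverts G"
  then show ?thesis
    unfolding raag_gen_def raag_algebra_def carrier_dga_quotient
    by (intro a_rcosetsI a_subset exterior_gen_carrier)
qed

lemma raag_gen_degree_one: "v \<in> pverts G \<Longrightarrow> raag_gen G v \<in> homog (raag_algebra G) 1"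
  by (auto simp: raag_gen_def raag_algebra_def exterior_gen_def exterior_algebra_def
      dga_quotient_def tensor_algebra_def)

text \<open>
  The differential contributes pure tensors with zero left factor and the bracket contributes
  pure tensors with zero right factor; both kinds vanish in the tensor product.
\<close>

lemma (in lie_algebra) raag_tuple_flat:
  assumes comm: "\<And>v w. \<lbrakk>v \<in> pverts G; w \<in> pverts G\<rbrakk> \<Longrightarrow> bracket (\<omega> v) (\<omega> w) = 0"
  shows "raag_tuple G smul \<omega> \<in> flat_connections (raag_algebra G) smul bracket"
proof -
  let ?A = "raag_algebra G" and ?R = "tensor_relations (raag_algebra G) smul"
  interpret complex_vector_space smul by unfold_locales
  interpret A: ring ?A by (rule ring_raag_algebra)
  interpret pm: vector_space pm_scale by (rule vector_space_pm_scale)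
  have R: "pm.subspace ?R"
    unfolding tensor_relations_def by (rule pm.subspace_span)
  define t where "t = (\<Sum>v\<in>pverts G. Poly_Mapping.single (raag_gen G v, \<omega> v) (1 :: complex))"
  have keys: "Poly_Mapping.keys t \<subseteq> (\<lambda>v. (raag_gen G v, \<omega> v)) ` pverts G"
    unfolding t_def by (rule order_trans[OF Poly_Mapping.keys_sum]) auto
  have "tensor_differential ?A t \<in> ?R"
    unfolding tensor_differential_def linear_ext_def
  proof (rule pm.subspace_sum[OF R])
    fix s assume "s \<in> Poly_Mapping.keys t"
    then obtain v where "v \<in> pverts G" "s = (raag_gen G v, \<omega> v)"
      using keys by auto
    then show "Poly_Mapping.single ((\<lambda>(a, x). (differential ?A a, x)) s) (Poly_Mapping.lookup t s) \<in> ?R"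
      by (simp add: differential_raag_algebra raag_gen_carrier single_zero_left_relation ring_raag_algebra)
  qed
  moreover have "tensor_bracket ?A bracket t t \<in> ?R"
    unfolding tensor_bracket_def bilinear_ext_def
  proof (intro pm.subspace_sum[OF R])
    fix s s' assume "s \<in> Poly_Mapping.keys t" "s' \<in> Poly_Mapping.keys t"
    then obtain v w where "v \<in> pverts G" "s = (raag_gen G v, \<omega> v)" "w \<in> pverts G" "s' = (raag_gen G w, \<omega> w)"
      using keys by blast
    then show "Poly_Mapping.single ((\<lambda>(a, x) (b, y). (a \<otimes>\<^bsub>?A\<^esub> b, bracket x y)) s s')
        (Poly_Mapping.lookup t s * Poly_Mapping.lookup t s') \<in> ?R"
      by (simp add: comm raag_gen_carrier single_zero_right_relation)
  qed
  ultimately have r: "tensor_differential ?A t + pm_scale (1/2) (tensor_bracket ?A bracket t t) \<in> ?R"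
    by (intro pm.subspace_add[OF R] pm.subspace_scale[OF R])
  have "tensor_class ?A smul r = tensor_class ?A smul 0" if "r \<in> ?R" for r
  proof -
    have "\<exists>s'. r + s = s' \<and> s' \<in> ?R" "\<exists>s'. s = r + s' \<and> s' \<in> ?R" if "s \<in> ?R" for s
      using pm.subspace_add[OF R \<open>r \<in> ?R\<close> that] pm.subspace_diff[OF R that \<open>r \<in> ?R\<close>]
      by (auto intro: exI[of _ "s - r"])
    then show ?thesis
      by (auto simp: tensor_class_def)
  qed
  moreover have "Poly_Mapping.keys t \<subseteq> homog ?A 1 \<times> UNIV"
    using keys raag_gen_degree_one by fastforce
  ultimately show ?thesis
    using r unfolding flat_connections_def raag_tuple_def t_def[symmetric] by blast
qed

section \<open>The single edge\<close>

definition edge_graph :: "nat pair_pre_digraph" where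
  "edge_graph = \<lparr>pverts = {0, 1}, parcs = {(0, 1), (1, 0)}\<rparr>"

lemma pverts_edge_graph: "pverts edge_graph = {0, 1}"
  by (simp add: edge_graph_def)

lemma pair_graph_edge_graph: "pair_graph edge_graph"
  by unfold_locales (auto simp: edge_graph_def symmetric_def intro!: symI)

lemma edge_graph_reachable:
  assumes "u \<in> {0, 1}" "v \<in> {0, 1}"
  shows "u \<rightarrow>\<^sup>*\<^bsub>with_proj edge_graph\<^esub> v"
proof -
  interpret pair_graph edge_graph by (rule pair_graph_edge_graph)
  have "u = v \<and> u \<in> pverts edge_graph \<or> (u, v) \<in> parcs edge_graph"
    using assms by (auto simp: edge_graph_def)
  then show ?thesis
    by auto
qed

lemma connected_edge_graph: "Digraph_Component.connected (with_proj edge_graph)"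
proof -
  have "mk_symmetric (with_proj edge_graph) = edge_graph"
    by (auto simp: mk_symmetric_def edge_graph_def)
  moreover have "pverts edge_graph = {0, 1}"
    by (simp add: edge_graph_def)
  ultimately show ?thesis
    using edge_graph_reachable by (simp add: connected_def strongly_connected_def)
qed

lemma edge_graph_component: "{0, 1} \<in> pre_digraph.sccs_verts (with_proj edge_graph \<restriction> {0, 1})"
proof -
  have restrict: "with_proj edge_graph \<restriction> {0, 1} = with_proj edge_graph"
    by (auto simp: induce_subgraph_def edge_graph_def with_proj_def)
  interpret pair_graph edge_graph by (rule pair_graph_edge_graph)
  have closed: "v \<in> {0, 1}" if "u \<rightarrow>\<^sup>*\<^bsub>with_proj edge_graph\<^esub> v" for u v
    using reachable_in_verts(2)[OF that] by (simp add: edge_graph_def)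
  show ?thesis
    unfolding restrict in_sccs_verts_conv_reachable
  proof (intro conjI ballI allI impI)
    show "{0, 1} \<noteq> ({} :: nat set)"
      by simp
  next
    fix u v :: nat
    assume "u \<in> {0, 1}" "v \<in> {0, 1}"
    then show "u \<rightarrow>\<^sup>*\<^bsub>with_proj edge_graph\<^esub> v"
      by (rule edge_graph_reachable)
  next
    fix u v :: nat
    assume "v \<notin> {0, 1}"
    then have "\<not> u \<rightarrow>\<^sup>*\<^bsub>with_proj edge_graph\<^esub> v"
      by (rule contrapos_nn) (rule closed)
    then show "\<not> u \<rightarrow>\<^sup>*\<^bsub>with_proj edge_graph\<^esub> v \<or> \<not> v \<rightarrow>\<^sup>*\<^bsub>with_proj edge_graph\<^esub> u"
      by (rule disjI1)
  qed
qed

context lie_algebra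
begin

text \<open>
  Both entries are nonzero, so \<open>W\<close> must contain both vertices. They form one component,
  on which the entries span a plane.
\<close>

lemma commuting_pair_not_in_S_set:
  assumes "x \<noteq> 0" "y \<notin> span {x}"
    and "W \<subseteq> {0, 1}"
  shows "raag_tuple edge_graph smul (\<lambda>v. if v = 0 then x else y) \<notin> S_set edge_graph smul W"
proof
  interpret complex_vector_space smul by unfold_locales
  note V = pverts_edge_graph
  assume "raag_tuple edge_graph smul (\<lambda>v. if v = 0 then x else y) \<in> S_set edge_graph smul W"
  then obtain \<omega> where \<omega>: "raag_tuple edge_graph smul (\<lambda>v. if v = 0 then x else y) = raag_tuple edge_graph smul \<omega>"
    and zero: "\<And>v. v \<in> {0, 1} - W \<Longrightarrow> \<omega> v = 0"
    and rank: "\<And>C. C \<in> pre_digraph.sccs_verts (with_proj edge_graph \<restriction> W) \<Longrightarrow> dim (span (\<omega> ` C)) \<le> 1"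
    unfolding S_set_def V by auto
  have "\<omega> 0 = x" "\<omega> 1 = y"
    using raag_tuple_eqD[OF _ _ \<omega>, of 0] raag_tuple_eqD[OF _ _ \<omega>, of 1] by (simp_all add: V)
  moreover have "y \<noteq> 0"
    using assms(2) span_zero by auto
  ultimately have "W = {0, 1}"
    using zero[of 0] zero[of 1] assms(1,3) by auto
  then have "dim (span (\<omega> ` {0, 1})) \<le> 1"
    by (intro rank) (simp only: edge_graph_component)
  then have "dim (span {x, y}) \<le> 1"
    by (simp only: image_insert image_empty \<open>\<omega> 0 = x\<close> \<open>\<omega> 1 = y\<close>)
  moreover have "independent {y, x}"
    using assms(1,2) independent_insertI[OF _ independent_insertI[OF _ independent_empty], of y x] by simp
  moreover have "y \<noteq> x"
    using assms(2) span_base[of x "{x}"] by auto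
  ultimately show False
    using dim_span_eq_card_independent[of "{y, x}"] by (simp add: insert_commute)
qed

end

theorem proposition6p6:
  fixes smul :: "complex \<Rightarrow> 'g::ab_group_add \<Rightarrow> 'g"
    and bracket :: "'g \<Rightarrow> 'g \<Rightarrow> 'g"
  assumes "lie_algebra smul bracket"
    and "lie_algebra.finite_dimensional smul"
    and "(UNIV :: 'g set) \<noteq> {0}"
    and "lie_algebra.semisimple smul bracket"
    and "\<not> lie_algebra.isomorphic_sl2 smul bracket"
  shows "\<exists>G :: nat pair_pre_digraph.
    pair_graph G \<and> Digraph_Component.connected (with_proj G) \<and>
    flat_connections (raag_algebra G) smul bracket
      \<noteq> (\<Union>W\<in>Pow (pverts G). S_set G smul W)"
proof -
  interpret lie_algebra smul bracket by fact
  have "\<not> centralizers_are_lines"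
    using assms(5) by (rule contrapos_nn) (rule sl2_if_centralizers_are_lines[OF assms(2-4)])
  then obtain x y where x: "x \<noteq> 0" and xy: "bracket x y = 0" and y: "\<And>c. y \<noteq> smul c x"
    unfolding centralizers_are_lines_def by auto
  have y_span: "y \<notin> span {x}"
    using y by (auto simp: span_singleton)
  define \<omega> where "\<omega> v = (if v = 0 then x else y)" for v :: nat
  have "bracket y x = 0"
    by (simp add: bracket_anticommute[of y x] xy)
  then have "bracket (\<omega> v) (\<omega> w) = 0" for v w
    using xy bracket_self[of x] bracket_self[of y] by (simp add: \<omega>_def)
  then have flat: "raag_tuple edge_graph smul \<omega> \<in> flat_connections (raag_algebra edge_graph) smul bracket"
    by (rule raag_tuple_flat)
  have "raag_tuple edge_graph smul \<omega> \<notin> S_set edge_graph smul W" if "W \<subseteq> {0, 1}" for W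
    unfolding \<omega>_def by (rule commuting_pair_not_in_S_set[OF x y_span that])
  then have not_S: "raag_tuple edge_graph smul \<omega> \<notin> (\<Union>W\<in>Pow (pverts edge_graph). S_set edge_graph smul W)"
    unfolding pverts_edge_graph by blast
  have "flat_connections (raag_algebra edge_graph) smul bracket
      \<noteq> (\<Union>W\<in>Pow (pverts edge_graph). S_set edge_graph smul W)"
    using flat not_S by metis
  then show ?thesis
    by (intro exI[of _ edge_graph] conjI pair_graph_edge_graph connected_edge_graph)
qed

end
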